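(* Let $I$ be a squarefree strongly stable ideal of $S=K[x_1,\ldots,x_n]$ ($K$ a field), $n\ge4$, with initial degree $2$ and with a corner in degree $2$. Then (1) $I$ has at most $n-2$ corners for $n=4$; (2) $I$ has at most $n-3$ corners for $n\ge5$.
   Context: For a monomial $u$, $\mathrm{supp}(u)=\{i: x_i\mid u\}$. For a monomial ideal $I$, $G(I)$ is its minimal set of monomial generators. A squarefree monomial ideal $I$ (i.e. generated by squarefree monomials) is squarefree strongly stable if for all $u\in G(I)$ one has $(x_ju)/x_i\in I$ for all $i\in\mathrm{supp}(u)$ and all $j<i$ with $j\notin\mathrm{supp}(u)$. The initial degree of a graded ideal $I$ is the minimum $j$ with $I_j\ne0$. For a graded ideal $I$, $\beta_{i,j}(I)=\dim_K\mathrm{Tor}_i(K,I)_j$. A graded Betti number $\beta_{k,k+\ell}(I)\ne0$ is extremal if $\beta_{i,i+j}(I)=0$ for all $i\ge k$, $j\ge\ell$, $(i,j)\ne(k,\ell)$; the pair $(k,\ell)$ is then called a corner of $I$ (a corner in degree $\ell$). *)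

theory Defs
  imports Complex_Main "HOL-Library.Poly_Mapping" "HOL-Library.Function_Algebras" "HOL.Hull"
begin

text \<open>A monomial is given by its exponent vector, of type \<^typ>\<open>nat \<Rightarrow>\<^sub>0 nat\<close>, and polynomials are
  finitely supported functions on exponent vectors. The ring \<open>S = K[x\<^sub>1, \<dots>, x\<^sub>n]\<close> is the subring
  \<open>polyring n\<close> of polynomials that involve only the variables with index in \<open>{1..n}\<close>; its
  coefficient field \<open>K\<close> is the type \<open>'k\<close>.\<close>

type_synonym mon = "nat \<Rightarrow>\<^sub>0 nat"
type_synonym 'k mpoly = "mon \<Rightarrow>\<^sub>0 'k"

definition supp :: "mon \<Rightarrow> nat set"
  where "supp u = Poly_Mapping.keys u"

definition Mon :: "nat \<Rightarrow> mon set"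
  where "Mon n = {u. supp u \<subseteq> {1..n}}"

definition polyring :: "nat \<Rightarrow> 'k::field mpoly set"
  where "polyring n = {p. Poly_Mapping.keys p \<subseteq> Mon n}"

definition xmon :: "mon \<Rightarrow> 'k::field mpoly"
  where "xmon u = Poly_Mapping.single u 1"

definition var :: "nat \<Rightarrow> mon"
  where "var i = Poly_Mapping.single i 1"

definition tdeg :: "mon \<Rightarrow> nat"
  where "tdeg u = (\<Sum>i\<in>Poly_Mapping.keys u. Poly_Mapping.lookup u i)"

definition is_ideal :: "nat \<Rightarrow> 'k::field mpoly set \<Rightarrow> bool"
  where "is_ideal n I \<longleftrightarrow> I \<subseteq> polyring n \<and> 0 \<in> I \<and> (\<forall>p\<in>I. \<forall>q\<in>I. p + q \<in> I) \<and> (\<forall>s\<in>polyring n. \<forall>p\<in>I. s * p \<in> I)"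

definition monomial_ideal :: "nat \<Rightarrow> mon set \<Rightarrow> 'k::field mpoly set"
  where "monomial_ideal n U = is_ideal n hull (xmon ` U)"

definition sqfree_mon :: "mon \<Rightarrow> bool"
  where "sqfree_mon u \<longleftrightarrow> (\<forall>i. Poly_Mapping.lookup u i \<le> 1)"

definition squarefree_monomial_ideal :: "nat \<Rightarrow> 'k::field mpoly set \<Rightarrow> bool"
  where "squarefree_monomial_ideal n I \<longleftrightarrow> (\<exists>U \<subseteq> Mon n. (\<forall>u\<in>U. sqfree_mon u) \<and> I = monomial_ideal n U)"

text \<open>The unique set of monomials that is minimal with respect to inclusion among those generating
  \<open>I\<close>; \<open>min_gens_eq\<close> below shows that it exists and describes it by divisibility.\<close>

definition min_gens :: "nat \<Rightarrow> 'k::field mpoly set \<Rightarrow> mon set"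
  where "min_gens n I = (THE U. U \<subseteq> Mon n \<and> monomial_ideal n U = I \<and> (\<forall>V. V \<subset> U \<longrightarrow> monomial_ideal n V \<noteq> I))"

definition squarefree_strongly_stable :: "nat \<Rightarrow> 'k::field mpoly set \<Rightarrow> bool"
  where "squarefree_strongly_stable n I \<longleftrightarrow>
    squarefree_monomial_ideal n I \<and>
    (\<forall>u\<in>min_gens n I. \<forall>i\<in>supp u. \<forall>j\<in>{1..<i}. j \<notin> supp u \<longrightarrow> xmon (u + var j - var i) \<in> I)"

definition homog_part :: "'k::field mpoly set \<Rightarrow> nat \<Rightarrow> 'k mpoly set"
  where "homog_part I d = {p\<in>I. \<forall>u\<in>Poly_Mapping.keys p. tdeg u = d}"

definition has_initial_degree :: "'k::field mpoly set \<Rightarrow> nat \<Rightarrow> bool"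
  where "has_initial_degree I d \<longleftrightarrow> homog_part I d \<noteq> {0} \<and> (\<forall>j<d. homog_part I j = {0})"

text \<open>The Koszul complex of \<open>x\<^sub>1, \<dots>, x\<^sub>n\<close> is a graded free resolution of \<open>K\<close> over \<open>S\<close>; its module in
  homological degree \<open>i\<close> has the basis \<open>e\<^sub>T\<close>, of degree \<open>i\<close>, for the \<open>i\<close>-element subsets
  \<open>T\<close> of \<open>{1..n}\<close>. Tensoring it with \<open>I\<close> gives a complex whose homology is \<open>Tor(K, I)\<close>:
  \<open>koszul n I i j\<close> is the degree \<open>j\<close> part of its module in homological degree \<open>i\<close>, with
  \<open>\<Sum> c\<^sub>T e\<^sub>T\<close>, \<open>c\<^sub>T \<in> I\<close>, given by the function \<open>c\<close>, and \<open>kdiff n\<close> is induced by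
  \<open>e\<^sub>U \<mapsto> \<Sum> (-1)\<^sup>r x\<^sub>k e\<^sub>T\<close>, the sum being over \<open>k \<in> U\<close>, with \<open>T = U - {k}\<close> and
  \<open>r\<close> the number of elements of \<open>U\<close> below \<open>k\<close>. That the Koszul complex itself
  (\<open>I = S\<close>) is a resolution of \<open>K\<close> is shown in \<open>koszul_exact\<close>, \<open>koszul_augmentation\<close>.\<close>

definition koszul :: "nat \<Rightarrow> 'k::field mpoly set \<Rightarrow> nat \<Rightarrow> nat \<Rightarrow> (nat set \<Rightarrow> 'k mpoly) set"
  where "koszul n I i j =
    {c. \<forall>T. c T \<in> (if T \<subseteq> {1..n} \<and> card T = i \<and> i \<le> j then homog_part I (j - i) else {0})}"

definition ksign :: "nat \<Rightarrow> nat set \<Rightarrow> 'k::field mpoly"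
  where "ksign k T = (-1) ^ card {t\<in>T. t < k}"

definition kdiff :: "nat \<Rightarrow> (nat set \<Rightarrow> 'k::field mpoly) \<Rightarrow> nat set \<Rightarrow> 'k mpoly"
  where "kdiff n c T = (\<Sum>k\<in>{1..n} - T. ksign k T * xmon (var k) * c (insert k T))"

definition kscale :: "'k::field \<Rightarrow> (nat set \<Rightarrow> 'k mpoly) \<Rightarrow> nat set \<Rightarrow> 'k mpoly"
  where "kscale a c T = Poly_Mapping.single 0 a * c T"

global_interpretation kvs: vector_space kscale
proof
  fix a b :: 'a and x y :: "nat set \<Rightarrow> 'a mpoly"
  show "kscale a (x + y) = kscale a x + kscale a y"
    by (rule ext) (simp add: kscale_def algebra_simps)
  show "kscale (a + b) x = kscale a x + kscale b x"
    by (rule ext) (simp add: kscale_def single_add algebra_simps)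
  show "kscale a (kscale b x) = kscale (a * b) x"
    by (rule ext) (simp add: kscale_def mult_single mult.assoc[symmetric])
  show "kscale 1 x = x"
    by (rule ext) (simp add: kscale_def)
qed

definition kcycles :: "nat \<Rightarrow> 'k::field mpoly set \<Rightarrow> nat \<Rightarrow> nat \<Rightarrow> (nat set \<Rightarrow> 'k mpoly) set"
  where "kcycles n I i j = {c \<in> koszul n I i j. kdiff n c = 0}"

definition kboundaries :: "nat \<Rightarrow> 'k::field mpoly set \<Rightarrow> nat \<Rightarrow> nat \<Rightarrow> (nat set \<Rightarrow> 'k mpoly) set"
  where "kboundaries n I i j = kdiff n ` koszul n I (Suc i) j"

text \<open>\<open>\<beta>\<^bsub>i,j\<^esub>(I) = dim\<^sub>K Tor\<^sub>i(K, I)\<^sub>j\<close>. The boundaries form a subspace of the cycles, which are a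
  finite-dimensional space (\<open>kboundaries_le_kcycles\<close>, \<open>koszul_finite_dim\<close> below), so
  the difference is the dimension of the homology.\<close>

definition betti :: "nat \<Rightarrow> 'k::field mpoly set \<Rightarrow> nat \<Rightarrow> nat \<Rightarrow> nat"
  where "betti n I i j = kvs.dim (kcycles n I i j) - kvs.dim (kboundaries n I i j)"

definition corner :: "nat \<Rightarrow> 'k::field mpoly set \<Rightarrow> nat \<times> nat \<Rightarrow> bool"
  where "corner n I = (\<lambda>(k, l). betti n I k (k + l) \<noteq> 0 \<and>
    (\<forall>i\<ge>k. \<forall>j\<ge>l. (i, j) \<noteq> (k, l) \<longrightarrow> betti n I i (i + j) = 0))"

subsection \<open>Minimal monomial generators\<close>

lemma lookup_single_mult:
  fixes p :: "'k::field mpoly"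
  shows "Poly_Mapping.lookup (Poly_Mapping.single v a * p) u =
    (if \<exists>w. u = v + w then a * Poly_Mapping.lookup p (u - v) else 0)"
proof -
  let ?K = "Poly_Mapping.keys p"
  have p: "p = (\<Sum>w\<in>?K. Poly_Mapping.single w (Poly_Mapping.lookup p w))"
    by (rule poly_mapping_eqI) (simp add: lookup_sum lookup_single when_def in_keys_iff)
  have "Poly_Mapping.single v a * p =
      (\<Sum>w\<in>?K. Poly_Mapping.single (v + w) (a * Poly_Mapping.lookup p w))"
    by (subst p) (simp add: sum_distrib_left mult_single)
  then have "Poly_Mapping.lookup (Poly_Mapping.single v a * p) u =
      (\<Sum>w\<in>?K. if v + w = u then a * Poly_Mapping.lookup p w else 0)"
    by (simp add: lookup_sum lookup_single when_def)
  also have "\<dots> = (if \<exists>w. u = v + w then a * Poly_Mapping.lookup p (u - v) else 0)"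
  proof (cases "\<exists>w. u = v + w")
    case True
    then obtain w0 where w0: "u = v + w0" by blast
    then have "(\<Sum>w\<in>?K. if v + w = u then a * Poly_Mapping.lookup p w else 0)
        = (\<Sum>w\<in>?K. if w = w0 then a * Poly_Mapping.lookup p w else 0)"
      by (intro sum.cong) auto
    also have "\<dots> = a * Poly_Mapping.lookup p w0"
      by (simp add: in_keys_iff)
    finally show ?thesis using w0 by auto
  next
    case False
    then show ?thesis by (auto intro!: sum.neutral)
  qed
  finally show ?thesis .
qed

lemma supp_add: "supp (u + v) = supp u \<union> supp v"
  by (auto simp: supp_def in_keys_iff lookup_add)

lemma Mon_add: "u + v \<in> Mon n \<longleftrightarrow> u \<in> Mon n \<and> v \<in> Mon n"
  by (auto simp: Mon_def supp_add)

lemma tdeg_superset: "finite A \<Longrightarrow> supp u \<subseteq> A \<Longrightarrow> tdeg u = (\<Sum>i\<in>A. Poly_Mapping.lookup u i)"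
  unfolding tdeg_def supp_def by (rule sum.mono_neutral_left) (auto simp: in_keys_iff)

lemma tdeg_add: "tdeg (u + v) = tdeg u + tdeg v"
proof -
  have "finite (supp u \<union> supp v)" by (simp add: supp_def)
  then show ?thesis
    using tdeg_superset[of "supp u \<union> supp v" u] tdeg_superset[of "supp u \<union> supp v" v]
      tdeg_superset[of "supp u \<union> supp v" "u + v"]
    by (simp add: supp_add lookup_add sum.distrib)
qed

lemma tdeg_eq_0: "tdeg u = 0 \<longleftrightarrow> u = 0"
  unfolding tdeg_def by (auto simp: in_keys_iff intro!: poly_mapping_eqI)

lemma is_ideal_polyring: "is_ideal n (polyring n)"
  unfolding is_ideal_def polyring_def
proof (intro conjI ballI)
  fix s p :: "'a mpoly"
  assume s: "s \<in> {p. Poly_Mapping.keys p \<subseteq> Mon n}" and p: "p \<in> {p. Poly_Mapping.keys p \<subseteq> Mon n}"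
  show "s + p \<in> {p. Poly_Mapping.keys p \<subseteq> Mon n}"
    using s p keys_add[of s p] by auto
  show "s * p \<in> {p. Poly_Mapping.keys p \<subseteq> Mon n}"
    using s p keys_mult[of s p] by (fastforce simp: Mon_add)
qed auto

lemma is_ideal_hull:
  assumes "X \<subseteq> polyring n" shows "is_ideal n (is_ideal n hull X)"
proof -
  have "is_ideal n hull X \<subseteq> polyring n"
    using assms is_ideal_polyring by (rule hull_minimal)
  then show ?thesis
    unfolding is_ideal_def hull_def by blast
qed

lemma ideal_sum:
  assumes "is_ideal n I" "\<And>x. x \<in> A \<Longrightarrow> f x \<in> I" shows "sum f A \<in> I"
  using assms by (induction A rule: infinite_finite_induct) (auto simp: is_ideal_def)

lemma xmon_in_polyring: "u \<in> Mon n \<Longrightarrow> xmon u \<in> polyring n"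
  by (auto simp: xmon_def polyring_def)

lemma monomial_ideal_iff:
  fixes p :: "'k::field mpoly"
  assumes U: "U \<subseteq> Mon n"
  shows "p \<in> monomial_ideal n U \<longleftrightarrow>
    p \<in> polyring n \<and> (\<forall>u\<in>Poly_Mapping.keys p. \<exists>v\<in>U. \<exists>w. u = v + w)"
proof -
  let ?D = "{p :: 'k mpoly. p \<in> polyring n \<and> (\<forall>u\<in>Poly_Mapping.keys p. \<exists>v\<in>U. \<exists>w. u = v + w)}"
  have add: "p + q \<in> ?D" if "p \<in> ?D" "q \<in> ?D" for p q :: "'k mpoly"
  proof -
    have "p + q \<in> polyring n"
      using that is_ideal_polyring[of n] by (auto simp: is_ideal_def)
    moreover have "\<exists>v\<in>U. \<exists>w. u = v + w" if u: "u \<in> Poly_Mapping.keys (p + q)" for u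
      using subsetD[OF keys_add u] \<open>p \<in> ?D\<close> \<open>q \<in> ?D\<close> by blast
    ultimately show ?thesis by simp
  qed
  have mult: "s * p \<in> ?D" if sp: "s \<in> polyring n" "p \<in> ?D" for s p :: "'k mpoly"
  proof -
    have "s * p \<in> polyring n"
      using that is_ideal_polyring[of n] by (auto simp: is_ideal_def)
    moreover have "\<exists>v\<in>U. \<exists>w. u = v + w" if u: "u \<in> Poly_Mapping.keys (s * p)" for u
    proof -
      obtain a b where ab: "u = a + b" "b \<in> Poly_Mapping.keys p"
        using subsetD[OF keys_mult u] by blast
      then obtain v w where "v \<in> U" "b = v + w" using sp by auto
      then show ?thesis using ab by (metis add.left_commute)
    qed
    ultimately show ?thesis by simp
  qed
  have "(0 :: 'k mpoly) \<in> ?D" by (simp add: polyring_def)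
  then have D: "is_ideal n ?D"
    unfolding is_ideal_def by (intro conjI ballI add mult) auto
  have sub: "(xmon ` U :: 'k mpoly set) \<subseteq> polyring n"
    using U xmon_in_polyring by blast
  have "(xmon ` U :: 'k mpoly set) \<subseteq> ?D"
    using sub by (auto simp: xmon_def intro!: exI[of _ 0])
  then have "(monomial_ideal n U :: 'k mpoly set) \<subseteq> ?D"
    unfolding monomial_ideal_def using D by (rule hull_minimal)
  moreover have "p \<in> monomial_ideal n U" if p: "p \<in> ?D" for p :: "'k mpoly"
  proof -
    let ?K = "Poly_Mapping.keys p"
    have I: "is_ideal n (monomial_ideal n U :: 'k mpoly set)"
      unfolding monomial_ideal_def using sub by (rule is_ideal_hull)
    have "p = (\<Sum>w\<in>?K. Poly_Mapping.single w (Poly_Mapping.lookup p w))"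
      by (rule poly_mapping_eqI) (simp add: lookup_sum lookup_single when_def in_keys_iff)
    also have "\<dots> \<in> monomial_ideal n U"
    proof (rule ideal_sum[OF I])
      fix u assume u: "u \<in> ?K"
      then obtain v w where vw: "v \<in> U" "u = v + w" using p by blast
      have "u \<in> Mon n" using u p by (auto simp: polyring_def)
      then have "w \<in> Mon n" using vw by (simp add: Mon_add)
      then have "Poly_Mapping.single w (Poly_Mapping.lookup p u) \<in> polyring n"
        by (auto simp: polyring_def)
      moreover have "(xmon v :: 'k mpoly) \<in> monomial_ideal n U"
        unfolding monomial_ideal_def using vw by (auto intro: hull_inc)
      moreover have "Poly_Mapping.single u (Poly_Mapping.lookup p u) =
          Poly_Mapping.single w (Poly_Mapping.lookup p u) * xmon v"
        by (simp add: xmon_def mult_single vw add.commute)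
      ultimately show "Poly_Mapping.single u (Poly_Mapping.lookup p u) \<in> monomial_ideal n U"
        using I by (simp add: is_ideal_def)
    qed
    finally show ?thesis .
  qed
  ultimately show ?thesis by blast
qed

lemma is_ideal_monomial_ideal: "U \<subseteq> Mon n \<Longrightarrow> is_ideal n (monomial_ideal n U)"
  unfolding monomial_ideal_def by (rule is_ideal_hull) (auto intro: xmon_in_polyring)

lemma min_gens_eq:
  fixes I :: "'k::field mpoly set"
  assumes U: "U \<subseteq> Mon n" and IU: "I = monomial_ideal n U"
  defines "M \<equiv> {u \<in> Mon n. xmon u \<in> I \<and> (\<forall>v w. u = v + w \<and> xmon v \<in> I \<longrightarrow> v = u)}"
  shows "min_gens n I = M" and "monomial_ideal n M = I"
proof -
  have M: "M \<subseteq> Mon n" by (auto simp: M_def)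
  have mem: "xmon u \<in> (monomial_ideal n V :: 'k mpoly set) \<longleftrightarrow> u \<in> Mon n \<and> (\<exists>v\<in>V. \<exists>w. u = v + w)"
    if "V \<subseteq> Mon n" for u V
    unfolding monomial_ideal_iff[OF that] by (auto simp: xmon_def polyring_def)
  have div: "\<exists>v\<in>M. \<exists>w. u = v + w" if "xmon u \<in> I" for u
    using that
  proof (induction "tdeg u" arbitrary: u rule: less_induct)
    case less
    show ?case
    proof (cases "u \<in> M")
      case True
      then show ?thesis by (intro bexI[of _ u] exI[of _ 0]) auto
    next
      case False
      have "u \<in> Mon n" using less.prems mem[OF U] IU by simp
      then obtain v w where vw: "u = v + w" "xmon v \<in> I" "v \<noteq> u"
        using False less.prems unfolding M_def by auto
      then have "tdeg w \<noteq> 0" by (auto simp: tdeg_eq_0)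
      then have "tdeg v < tdeg u" using vw by (simp add: tdeg_add)
      then obtain v' w' where "v' \<in> M" "v = v' + w'" using less.hyps vw by blast
      then show ?thesis using vw by (metis add.assoc)
    qed
  qed
  have sub: "M \<subseteq> V" if V: "V \<subseteq> Mon n" "monomial_ideal n V = I" for V
  proof
    fix u assume u: "u \<in> M"
    then have "xmon u \<in> (monomial_ideal n V :: 'k mpoly set)" using V by (simp add: M_def)
    then obtain v w where vw: "v \<in> V" "u = v + w" using mem[OF V(1)] by blast
    have "xmon v \<in> (monomial_ideal n V :: 'k mpoly set)"
      unfolding mem[OF V(1)] using vw V by (auto intro!: bexI[of _ v] exI[of _ 0])
    then have "v = u" using u vw V by (auto simp: M_def)
    then show "u \<in> V" using vw by simp
  qed
  show gen: "monomial_ideal n M = I"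
  proof (rule set_eqI)
    fix p :: "'k mpoly"
    have "(\<exists>v\<in>M. \<exists>w. u = v + w) \<longleftrightarrow> (\<exists>v\<in>U. \<exists>w. u = v + w)" if "u \<in> Mon n" for u
    proof
      assume "\<exists>v\<in>M. \<exists>w. u = v + w"
      then obtain v w where vw: "v \<in> M" "u = v + w" by blast
      then have "xmon v \<in> I" by (simp add: M_def)
      then obtain v' w' where "v' \<in> U" "v = v' + w'" using mem[OF U] IU by auto
      then show "\<exists>v\<in>U. \<exists>w. u = v + w" using vw by (metis add.assoc)
    next
      assume "\<exists>v\<in>U. \<exists>w. u = v + w"
      then have "xmon u \<in> I" using that mem[OF U] IU by simp
      then show "\<exists>v\<in>M. \<exists>w. u = v + w" by (rule div)
    qed
    then show "p \<in> monomial_ideal n M \<longleftrightarrow> p \<in> I"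
      unfolding IU monomial_ideal_iff[OF M] monomial_ideal_iff[OF U] polyring_def by blast
  qed
  show "min_gens n I = M"
    unfolding min_gens_def
  proof (rule the_equality)
    show "M \<subseteq> Mon n \<and> monomial_ideal n M = I \<and> (\<forall>V. V \<subset> M \<longrightarrow> monomial_ideal n V \<noteq> I)"
      using M gen sub by blast
  next
    fix V assume V: "V \<subseteq> Mon n \<and> monomial_ideal n V = I \<and> (\<forall>W. W \<subset> V \<longrightarrow> monomial_ideal n W \<noteq> I)"
    then have "M \<subseteq> V" using sub by blast
    then show "V = M" using V gen by blast
  qed
qed

subsection \<open>The Koszul complex\<close>

lemma xmon_var_dvd: "(\<exists>w. u = var k + w) \<longleftrightarrow> k \<in> supp u"
proof
  assume "k \<in> supp u"
  then have "u = var k + (u - var k)"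
    by (auto simp: var_def supp_def in_keys_iff lookup_add lookup_minus lookup_single when_def
        intro!: poly_mapping_eqI)
  then show "\<exists>w. u = var k + w" ..
qed (auto simp: supp_def in_keys_iff var_def lookup_add)

lemma lookup_ksign:
  "Poly_Mapping.lookup (ksign k T * p) u = (-1) ^ card {t\<in>T. t < k} * Poly_Mapping.lookup p u"
  unfolding ksign_def by (cases "even (card {t\<in>T. t < k})") auto

lemma lookup_kdiff:
  "Poly_Mapping.lookup (kdiff n c T) u = (\<Sum>k\<in>{k \<in> {1..n} - T. k \<in> supp u}.
    (-1) ^ card {t\<in>T. t < k} * Poly_Mapping.lookup (c (insert k T)) (u - var k))"
proof -
  have "Poly_Mapping.lookup (kdiff n c T) u = (\<Sum>k\<in>{1..n} - T. if k \<in> supp u then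
      (-1) ^ card {t\<in>T. t < k} * Poly_Mapping.lookup (c (insert k T)) (u - var k) else 0)"
    unfolding kdiff_def lookup_sum mult.assoc lookup_ksign xmon_def lookup_single_mult xmon_var_dvd
    by (intro sum.cong) auto
  also have "\<dots> = (\<Sum>k\<in>{k \<in> {1..n} - T. k \<in> supp u}.
      (-1) ^ card {t\<in>T. t < k} * Poly_Mapping.lookup (c (insert k T)) (u - var k))"
    by (rule sum.inter_filter[symmetric]) simp
  finally show ?thesis .
qed

lemma ksign_swap:
  assumes "k \<notin> T" "l \<notin> T" "k < l" "finite T"
  shows "ksign k T * ksign l (insert k T) = - (ksign l T * ksign k (insert l T))"
proof -
  have "{t \<in> insert k T. t < l} = insert k {t\<in>T. t < l}" "{t \<in> insert l T. t < k} = {t\<in>T. t < k}"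
    using assms by auto
  then show ?thesis using assms by (simp add: ksign_def)
qed

lemma kdiff_kdiff:
  fixes c :: "nat set \<Rightarrow> 'k::field mpoly"
  assumes T: "finite T"
  shows "kdiff n (kdiff n c) T = 0"
proof -
  let ?f = "\<lambda>k l. ksign k T * ksign l (insert k T) * xmon (var k) * xmon (var l)
    * c (insert l (insert k T))"
  let ?A = "{1..n} - T"
  let ?P = "{(k, l). k \<in> ?A \<and> l \<in> ?A \<and> k < l}" and ?Q = "{(k, l). k \<in> ?A \<and> l \<in> ?A \<and> l < k}"
  have fin: "finite ?P" "finite ?Q"
    by (auto intro: finite_subset[of _ "?A \<times> ?A"])
  have "kdiff n (kdiff n c) T = (\<Sum>k\<in>?A. \<Sum>l\<in>{1..n} - insert k T. ?f k l)"
    unfolding kdiff_def by (simp add: sum_distrib_left algebra_simps)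
  also have "\<dots> = (\<Sum>(k, l)\<in>Sigma ?A (\<lambda>k. {1..n} - insert k T). ?f k l)"
    by (rule sum.Sigma) auto
  also have "Sigma ?A (\<lambda>k. {1..n} - insert k T) = ?P \<union> ?Q" by auto
  also have "(\<Sum>(k, l)\<in>?P \<union> ?Q. ?f k l) = (\<Sum>(k, l)\<in>?P. ?f k l) + (\<Sum>(k, l)\<in>?Q. ?f k l)"
    using fin by (intro sum.union_disjoint) auto
  also have "(\<Sum>(k, l)\<in>?Q. ?f k l) = (\<Sum>(k, l)\<in>?P. ?f l k)"
    by (rule sum.reindex_bij_witness[of _ prod.swap prod.swap]) auto
  also have "(\<Sum>(k, l)\<in>?P. ?f l k) = (\<Sum>(k, l)\<in>?P. - ?f k l)"
  proof (rule sum.cong[OF refl], clarify)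
    fix k l assume "k \<in> {1..n}" "k \<notin> T" "l \<in> {1..n}" "l \<notin> T" "k < l"
    then show "?f l k = - ?f k l"
      using ksign_swap[of k T l, OF _ _ _ T, where 'a='k]
      by (simp add: insert_commute mult.assoc mult.left_commute[of "xmon (var l)"])
  qed
  also have "(\<Sum>(k, l)\<in>?P. ?f k l) + (\<Sum>(k, l)\<in>?P. - ?f k l) = 0"
    by (simp add: sum.distrib[symmetric] split_def)
  finally show ?thesis .
qed

lemma koszul_outside: "c \<in> koszul n I i j \<Longrightarrow> \<not> (T \<subseteq> {1..n} \<and> card T = i \<and> i \<le> j) \<Longrightarrow> c T = 0"
  by (auto simp: koszul_def split: if_splits dest: spec[of _ T])

lemma koszul_inside: "c \<in> koszul n I i j \<Longrightarrow> T \<subseteq> {1..n} \<Longrightarrow> card T = i \<Longrightarrow> i \<le> j \<Longrightarrow>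
    c T \<in> homog_part I (j - i)"
  by (auto simp: koszul_def dest: spec[of _ T])

lemma homog_part_add:
  assumes "is_ideal n I" "p \<in> homog_part I d" "q \<in> homog_part I d"
  shows "p + q \<in> homog_part I d"
  using assms keys_add[of p q] unfolding homog_part_def is_ideal_def by blast

lemma homog_part_mult:
  assumes I: "is_ideal n I" and s: "s \<in> homog_part (polyring n) d" and p: "p \<in> homog_part I e"
  shows "s * p \<in> homog_part I (d + e)"
  using assms keys_mult[of s p]
  by (fastforce simp: homog_part_def is_ideal_def tdeg_add)

lemma homog_part_zero: "is_ideal n I \<Longrightarrow> 0 \<in> homog_part I d"
  by (simp add: homog_part_def is_ideal_def)

lemma homog_part_sum:
  assumes "is_ideal n I" "\<And>x. x \<in> A \<Longrightarrow> f x \<in> homog_part I d" shows "sum f A \<in> homog_part I d"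
  using assms
  by (induction A rule: infinite_finite_induct) (auto intro: homog_part_zero homog_part_add)

lemma tdeg_var [simp]: "tdeg (var k) = 1"
  by (simp add: tdeg_def var_def)

lemma single_0_homog: "Poly_Mapping.single 0 a \<in> homog_part (polyring n) 0"
  by (auto simp: homog_part_def polyring_def Mon_def supp_def tdeg_def)

lemma ksign_homog: "ksign k T \<in> homog_part (polyring n) 0"
proof -
  have "ksign k T = Poly_Mapping.single 0 ((-1) ^ card {t\<in>T. t < k})"
    by (cases "even (card {t\<in>T. t < k})") (auto simp: ksign_def single_uminus)
  then show ?thesis by (metis single_0_homog)
qed

lemma xmon_var_homog: "k \<in> {1..n} \<Longrightarrow> xmon (var k) \<in> homog_part (polyring n) 1"
  by (auto simp: homog_part_def polyring_def Mon_def supp_def xmon_def var_def tdeg_def)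

lemma kdiff_in_koszul:
  assumes I: "is_ideal n I" and c: "c \<in> koszul n I (Suc i) j"
  shows "kdiff n c \<in> koszul n I i j"
  unfolding koszul_def
proof (intro CollectI allI)
  fix T
  show "kdiff n c T \<in> (if T \<subseteq> {1..n} \<and> card T = i \<and> i \<le> j then homog_part I (j - i) else {0})"
  proof (cases "T \<subseteq> {1..n} \<and> card T = i \<and> Suc i \<le> j")
    case True
    then have fin: "finite T" using finite_subset by blast
    have "ksign k T * xmon (var k) * c (insert k T) \<in> homog_part I (j - i)" if k: "k \<in> {1..n} - T" for k
    proof -
      have "c (insert k T) \<in> homog_part I (j - Suc i)"
        using True k fin by (intro koszul_inside[OF c]) auto
      then have "ksign k T * (xmon (var k) * c (insert k T)) \<in> homog_part I (0 + (1 + (j - Suc i)))"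
        using k by (intro homog_part_mult[OF I] ksign_homog xmon_var_homog) auto
      moreover have "0 + (1 + (j - Suc i)) = j - i" using True by arith
      ultimately show ?thesis by (simp only: mult.assoc)
    qed
    then have "kdiff n c T \<in> homog_part I (j - i)"
      unfolding kdiff_def by (rule homog_part_sum[OF I])
    then show ?thesis using True by auto
  next
    case False
    have "c (insert k T) = 0" if k: "k \<in> {1..n} - T" for k
    proof (rule koszul_outside[OF c], rule notI)
      assume a: "insert k T \<subseteq> {1..n} \<and> card (insert k T) = Suc i \<and> Suc i \<le> j"
      then have "finite T" using finite_subset[of T "{1..n}"] by auto
      then show False using a False k by auto
    qed
    then have "kdiff n c T = 0" unfolding kdiff_def by simp
    then show ?thesis using homog_part_zero[OF I] by auto
  qed
qed

lemma kboundaries_le_kcycles: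
  assumes I: "is_ideal n I" shows "kboundaries n I i j \<subseteq> kcycles n I i j"
proof
  fix b assume "b \<in> kboundaries n I i j"
  then obtain c where c: "c \<in> koszul n I (Suc i) j" "b = kdiff n c"
    by (auto simp: kboundaries_def)
  have "kdiff n (kdiff n c) T = 0" for T
  proof (cases "finite T")
    case False
    have "kdiff n c (insert k T) = 0" for k
      using False finite_subset[of T "{1..n}"]
      by (intro koszul_outside[OF kdiff_in_koszul[OF I c(1)]]) auto
    then show ?thesis by (simp add: kdiff_def[of n "kdiff n c"])
  qed (rule kdiff_kdiff)
  then show "b \<in> kcycles n I i j"
    using kdiff_in_koszul[OF I c(1)] c(2) by (auto simp: kcycles_def)
qed

lemma kdiff_add: "kdiff n (x + y) = kdiff n x + kdiff n y"
  by (rule ext) (simp add: kdiff_def algebra_simps sum.distrib)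

lemma kdiff_kscale: "kdiff n (kscale a x) = kscale a (kdiff n x)"
  by (rule ext) (simp add: kdiff_def kscale_def sum_distrib_left mult.left_commute)

lemma subspace_koszul:
  assumes I: "is_ideal n I" shows "kvs.subspace (koszul n I i j)"
proof (rule kvs.subspaceI)
  show "0 \<in> koszul n I i j" using homog_part_zero[OF I] by (auto simp: koszul_def)
next
  fix x y assume x: "x \<in> koszul n I i j" and y: "y \<in> koszul n I i j"
  show "x + y \<in> koszul n I i j"
    unfolding koszul_def
  proof (intro CollectI allI)
    fix T
    show "(x + y) T \<in> (if T \<subseteq> {1..n} \<and> card T = i \<and> i \<le> j then homog_part I (j - i) else {0})"
    proof (cases "T \<subseteq> {1..n} \<and> card T = i \<and> i \<le> j")
      case True
      then have "x T \<in> homog_part I (j - i)" "y T \<in> homog_part I (j - i)"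
        using koszul_inside[OF x] koszul_inside[OF y] by blast+
      from homog_part_add[OF I this] show ?thesis using True by simp
    next
      case False
      from koszul_outside[OF x this] koszul_outside[OF y this] show ?thesis
        using homog_part_zero[OF I] by simp
    qed
  qed
next
  fix a x assume x: "x \<in> koszul n I i j"
  show "kscale a x \<in> koszul n I i j"
    unfolding koszul_def
  proof (intro CollectI allI)
    fix T
    show "kscale a x T \<in> (if T \<subseteq> {1..n} \<and> card T = i \<and> i \<le> j then homog_part I (j - i) else {0})"
    proof (cases "T \<subseteq> {1..n} \<and> card T = i \<and> i \<le> j")
      case True
      then have "x T \<in> homog_part I (j - i)" using koszul_inside[OF x] by blast
      from homog_part_mult[OF I single_0_homog this, of a] show ?thesis
        using True by (simp add: kscale_def)
    next
      case False
      from koszul_outside[OF x this] show ?thesis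
        using homog_part_zero[OF I] by (simp add: kscale_def)
    qed
  qed
qed

lemma subspace_kcycles: "is_ideal n I \<Longrightarrow> kvs.subspace (kcycles n I i j)"
  using subspace_koszul[of n I i j] unfolding kcycles_def kvs.subspace_def
  by (auto simp: kdiff_add kdiff_kscale) (auto simp: kdiff_def)

lemma subspace_kboundaries: "is_ideal n I \<Longrightarrow> kvs.subspace (kboundaries n I i j)"
  using subspace_koszul[of n I "Suc i" j] unfolding kboundaries_def kvs.subspace_def
  by (auto simp: kdiff_add[symmetric] kdiff_kscale[symmetric])
    (rule image_eqI[of _ _ 0], auto simp: kdiff_def)

lemma finite_Mon_deg: "finite {u \<in> Mon n. tdeg u = d}"
proof -
  let ?F = "{f. \<forall>i. (i \<in> {1..n} \<longrightarrow> f i \<in> {..d}) \<and> (i \<notin> {1..n} \<longrightarrow> f i = (0::nat))}"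
  have "Poly_Mapping.lookup ` {u \<in> Mon n. tdeg u = d} \<subseteq> ?F"
  proof (rule image_subsetI, rule CollectI)
    fix u assume "u \<in> {u \<in> Mon n. tdeg u = d}"
    then have u: "u \<in> Mon n" and d: "d = tdeg u" by auto
    have "Poly_Mapping.lookup u i \<le> tdeg u" for i
    proof (cases "i \<in> Poly_Mapping.keys u")
      case True
      then show ?thesis unfolding tdeg_def by (intro member_le_sum) auto
    qed (simp add: in_keys_iff)
    then show "\<forall>i. (i \<in> {1..n} \<longrightarrow> Poly_Mapping.lookup u i \<in> {..d}) \<and>
        (i \<notin> {1..n} \<longrightarrow> Poly_Mapping.lookup u i = 0)"
      using u d by (auto simp: Mon_def supp_def in_keys_iff)
  qed
  moreover have "finite ?F" by (rule finite_set_of_finite_funs) auto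
  ultimately have "finite (Poly_Mapping.lookup ` {u \<in> Mon n. tdeg u = d})"
    by (rule finite_subset)
  then show ?thesis
    by (rule finite_imageD) (simp add: inj_on_def)
qed

lemma koszul_finite_dim:
  assumes I: "is_ideal n (I :: 'k::field mpoly set)"
  shows "\<exists>B. finite B \<and> koszul n I i j \<subseteq> kvs.span B"
proof -
  define e :: "nat set \<Rightarrow> mon \<Rightarrow> nat set \<Rightarrow> 'k mpoly"
    where "e = (\<lambda>T u U. if U = T then xmon u else 0)"
  let ?M = "{u \<in> Mon n. tdeg u = j - i}"
  let ?B = "(\<lambda>(T, u). e T u) ` (Pow {1..n} \<times> ?M)"
  have app: "(\<Sum>x\<in>A. f x) U = (\<Sum>x\<in>A. f x U)" for f :: "'x \<Rightarrow> nat set \<Rightarrow> 'k mpoly" and A U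
    by (induction A rule: infinite_finite_induct) auto
  have "koszul n I i j \<subseteq> kvs.span ?B"
  proof
    fix c assume c: "c \<in> koszul n I i j"
    have keys: "Poly_Mapping.keys (c T) \<subseteq> ?M" for T
    proof (cases "T \<subseteq> {1..n} \<and> card T = i \<and> i \<le> j")
      case True
      then show ?thesis
        using koszul_inside[OF c, of T] I by (auto simp: homog_part_def is_ideal_def polyring_def)
    qed (simp add: koszul_outside[OF c])
    have "c = (\<Sum>T\<in>Pow {1..n}. \<Sum>u\<in>?M. kscale (Poly_Mapping.lookup (c T) u) (e T u))"
    proof (rule ext)
      fix U
      have c_eq: "c T = (\<Sum>u\<in>?M. Poly_Mapping.single u (Poly_Mapping.lookup (c T) u))" for T
      proof (rule poly_mapping_eqI)
        fix v
        have "Poly_Mapping.lookup (\<Sum>u\<in>?M. Poly_Mapping.single u (Poly_Mapping.lookup (c T) u)) v =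
            (\<Sum>u\<in>?M. if u = v then Poly_Mapping.lookup (c T) v else 0)"
          unfolding lookup_sum by (intro sum.cong) (auto simp: lookup_single when_def)
        also have "\<dots> = (if v \<in> ?M then Poly_Mapping.lookup (c T) v else 0)"
          using finite_Mon_deg by (rule sum.delta)
        also have "\<dots> = Poly_Mapping.lookup (c T) v"
        proof (cases "v \<in> ?M")
          case False
          then have "v \<notin> Poly_Mapping.keys (c T)" using keys[of T] by blast
          then show ?thesis by (simp add: in_keys_iff)
        qed simp
        finally show "Poly_Mapping.lookup (c T) v =
            Poly_Mapping.lookup (\<Sum>u\<in>?M. Poly_Mapping.single u (Poly_Mapping.lookup (c T) u)) v" ..
      qed
      have "(\<Sum>T\<in>Pow {1..n}. \<Sum>u\<in>?M. kscale (Poly_Mapping.lookup (c T) u) (e T u)) U =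
          (\<Sum>T\<in>Pow {1..n}. if T = U then c U else 0)"
        unfolding app
      proof (rule sum.cong[OF refl])
        fix T
        show "(\<Sum>u\<in>?M. kscale (Poly_Mapping.lookup (c T) u) (e T u) U) = (if T = U then c U else 0)"
        proof (cases "T = U")
          case True
          have "(\<Sum>u\<in>?M. kscale (Poly_Mapping.lookup (c T) u) (e T u) U) =
              (\<Sum>u\<in>?M. Poly_Mapping.single u (Poly_Mapping.lookup (c T) u))"
            using True by (intro sum.cong) (simp_all add: kscale_def e_def xmon_def mult_single)
          then show ?thesis using c_eq[of T] True by simp
        next
          case False
          then show ?thesis by (simp add: kscale_def e_def)
        qed
      qed
      also have "\<dots> = (if U \<in> Pow {1..n} then c U else 0)"
        by (rule sum.delta) simp
      also have "\<dots> = c U"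
        using koszul_outside[OF c, of U] by (cases "U \<subseteq> {1..n}") simp_all
      finally show "c U = (\<Sum>T\<in>Pow {1..n}. \<Sum>u\<in>?M. kscale (Poly_Mapping.lookup (c T) u) (e T u)) U" ..
    qed
    also have "\<dots> \<in> kvs.span ?B"
      by (intro kvs.span_sum kvs.span_scale kvs.span_base) auto
    finally show "c \<in> kvs.span ?B" .
  qed
  moreover have "finite ?B" using finite_Mon_deg[of n "j - i"] by simp
  ultimately show ?thesis by blast
qed

text \<open>In homological degree \<open>0\<close> the Koszul complex has homology \<open>K\<close>, in degree \<open>0\<close>.\<close>

lemma koszul_augmentation:
  "kboundaries n (polyring n) 0 0 = {0 :: nat set \<Rightarrow> 'k::field mpoly}"
  "kcycles n (polyring n) 0 0 =
    {c :: nat set \<Rightarrow> 'k mpoly. \<exists>a. c = (\<lambda>T. if T = {} then Poly_Mapping.single 0 a else 0)}"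
proof -
  show "kboundaries n (polyring n) 0 0 = {0 :: nat set \<Rightarrow> 'k mpoly}"
  proof -
    have "c = 0" if "c \<in> koszul n (polyring n) (Suc 0) 0" for c :: "nat set \<Rightarrow> 'k mpoly"
      by (rule ext) (simp add: koszul_outside[OF that])
    then have "koszul n (polyring n) (Suc 0) 0 = {0 :: nat set \<Rightarrow> 'k mpoly}"
      using kvs.subspace_0[OF subspace_koszul[OF is_ideal_polyring]] by blast
    moreover have "kdiff n 0 = (0 :: nat set \<Rightarrow> 'k mpoly)"
      by (rule ext) (simp add: kdiff_def)
    ultimately show ?thesis by (simp add: kboundaries_def)
  qed
  have hom: "p \<in> homog_part (polyring n) 0 \<longleftrightarrow> (\<exists>a. p = Poly_Mapping.single 0 a)" for p :: "'k mpoly"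
  proof
    assume "p \<in> homog_part (polyring n) 0"
    then have "Poly_Mapping.lookup p u = 0" if "u \<noteq> 0" for u
      using that by (auto simp: homog_part_def tdeg_eq_0 in_keys_iff)
    then have "p = Poly_Mapping.single 0 (Poly_Mapping.lookup p 0)"
      by (intro poly_mapping_eqI) (simp add: lookup_single when_def)
    then show "\<exists>a. p = Poly_Mapping.single 0 a" ..
  qed (auto simp: single_0_homog)
  have "c \<in> koszul n (polyring n) 0 0 \<longleftrightarrow> (\<exists>a. c = (\<lambda>T. if T = {} then Poly_Mapping.single 0 a else 0))"
    for c :: "nat set \<Rightarrow> 'k mpoly"
  proof
    assume c: "c \<in> koszul n (polyring n) 0 0"
    then obtain a where "c {} = Poly_Mapping.single 0 a"
      using koszul_inside[OF c, of "{}"] hom by auto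
    moreover have "c T = 0" if "T \<noteq> {}" for T
      using that finite_subset[of T "{1..n}"] by (intro koszul_outside[OF c]) auto
    ultimately have "c = (\<lambda>T. if T = {} then Poly_Mapping.single 0 a else 0)" by auto
    then show "\<exists>a. c = (\<lambda>T. if T = {} then Poly_Mapping.single 0 a else 0)" ..
  next
    assume "\<exists>a. c = (\<lambda>T. if T = {} then Poly_Mapping.single 0 a else 0)"
    then obtain a where a: "c = (\<lambda>T. if T = {} then Poly_Mapping.single 0 a else 0)" ..
    show "c \<in> koszul n (polyring n) 0 0"
      unfolding koszul_def
    proof (intro CollectI allI)
      fix T
      show "c T \<in> (if T \<subseteq> {1..n} \<and> card T = 0 \<and> 0 \<le> (0 :: nat)
          then homog_part (polyring n) (0 - 0) else {0})"
        using single_0_homog[of a n] homog_part_zero[OF is_ideal_polyring[of n], of 0, where 'a='k]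
        by (cases "T = {}") (auto simp: a)
    qed
  qed
  moreover have "kdiff n (\<lambda>T. if T = {} then p else 0) = 0" for p :: "'k mpoly"
    by (rule ext) (simp add: kdiff_def)
  ultimately show "kcycles n (polyring n) 0 0 =
      {c :: nat set \<Rightarrow> 'k mpoly. \<exists>a. c = (\<lambda>T. if T = {} then Poly_Mapping.single 0 a else 0)}"
    unfolding kcycles_def by auto
qed

text \<open>The contracting homotopy: with \<open>m\<close> the largest index occurring in \<open>x\<^sup>u e\<^sub>T\<close>, send it to
  \<open>\<plusminus> (x\<^sup>u / x\<^sub>m) e\<^sub>T\<^sub>'\<close>, \<open>T' = T \<union> {m}\<close>, or to \<open>0\<close> if \<open>m \<in> T\<close>.\<close>

definition khomotopy :: "(nat set \<Rightarrow> 'k::field mpoly) \<Rightarrow> nat set \<Rightarrow> 'k mpoly"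
  where "khomotopy c U = (if U = {} \<or> infinite U then 0 else
    Abs_poly_mapping (\<lambda>u. if supp u \<subseteq> {..Max U}
      then (-1) ^ (card U - 1) * Poly_Mapping.lookup (c (U - {Max U})) (u + var (Max U)) else 0))"

lemma lookup_khomotopy:
  assumes "U \<noteq> {}" "finite U"
  shows "Poly_Mapping.lookup (khomotopy c U) u = (if supp u \<subseteq> {..Max U}
      then (-1) ^ (card U - 1) * Poly_Mapping.lookup (c (U - {Max U})) (u + var (Max U)) else 0)"
proof -
  let ?f = "\<lambda>u. if supp u \<subseteq> {..Max U}
      then (-1) ^ (card U - 1) * Poly_Mapping.lookup (c (U - {Max U})) (u + var (Max U)) else 0"
  have "{u. ?f u \<noteq> 0} \<subseteq> (\<lambda>v. v - var (Max U)) ` Poly_Mapping.keys (c (U - {Max U}))"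
    by (auto simp: in_keys_iff intro!: image_eqI[of _ _ "_ + var (Max U)"] split: if_splits)
  then have "finite {u. ?f u \<noteq> 0}" by (rule finite_subset) simp
  then show ?thesis using assms by (simp add: khomotopy_def)
qed

lemma koszul_exact:
  assumes ij: "(i, j) \<noteq> (0, 0)"
  shows "kcycles n (polyring n) i j = (kboundaries n (polyring n) i j :: (nat set \<Rightarrow> 'k::field mpoly) set)"
proof
  show "(kboundaries n (polyring n) i j :: (nat set \<Rightarrow> 'k mpoly) set) \<subseteq> kcycles n (polyring n) i j"
    by (rule kboundaries_le_kcycles[OF is_ideal_polyring])
  show "(kcycles n (polyring n) i j :: (nat set \<Rightarrow> 'k mpoly) set) \<subseteq> kboundaries n (polyring n) i j"
  proof
    fix c :: "nat set \<Rightarrow> 'k mpoly"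
    assume "c \<in> kcycles n (polyring n) i j"
    then have c: "c \<in> koszul n (polyring n) i j" and dc: "kdiff n c = 0"
      by (auto simp: kcycles_def)
    let ?h = "khomotopy c"
    have c_nz: "T \<subseteq> {1..n} \<and> card T = i \<and> u \<in> Mon n \<and> i + tdeg u = j"
      if nz: "Poly_Mapping.lookup (c T) u \<noteq> 0" for T u
    proof (cases "T \<subseteq> {1..n} \<and> card T = i \<and> i \<le> j")
      case True
      then have "c T \<in> homog_part (polyring n) (j - i)" using koszul_inside[OF c] by blast
      then show ?thesis using True nz by (auto simp: homog_part_def polyring_def in_keys_iff)
    next
      case False
      then show ?thesis using koszul_outside[OF c, of T] nz by simp
    qed
    have h: "?h \<in> koszul n (polyring n) (Suc i) j"
      unfolding koszul_def
    proof (intro CollectI allI)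
      fix U
      have *: "U \<subseteq> {1..n} \<and> card U = Suc i \<and> u \<in> Mon n \<and> Suc i + tdeg u = j"
        if nz: "Poly_Mapping.lookup (?h U) u \<noteq> 0" for u
      proof -
        have U: "U \<noteq> {}" "finite U" using nz by (auto simp: khomotopy_def split: if_splits)
        then have "Poly_Mapping.lookup (c (U - {Max U})) (u + var (Max U)) \<noteq> 0"
          using nz by (auto simp: lookup_khomotopy split: if_splits)
        from c_nz[OF this] have cz: "U - {Max U} \<subseteq> {1..n}" "card (U - {Max U}) = i"
            "u \<in> Mon n" "var (Max U) \<in> Mon n" "i + tdeg (u + var (Max U)) = j"
          by (auto simp: Mon_add)
        have "Max U \<in> {1..n}" using cz(4) by (simp add: Mon_def var_def supp_def)
        moreover have "card U = Suc i" using cz(2) U by (metis Max_in card_Suc_Diff1)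
        ultimately show ?thesis using cz by (auto simp: tdeg_add)
      qed
      show "?h U \<in> (if U \<subseteq> {1..n} \<and> card U = Suc i \<and> Suc i \<le> j
          then homog_part (polyring n) (j - Suc i) else {0})"
      proof (cases "?h U = 0")
        case True
        then show ?thesis using homog_part_zero[OF is_ideal_polyring] by auto
      next
        case False
        then obtain u where "Poly_Mapping.lookup (?h U) u \<noteq> 0" 
          by (metis lookup_zero poly_mapping_eqI)
        from *[OF this] have "U \<subseteq> {1..n} \<and> card U = Suc i \<and> Suc i \<le> j" by auto
        moreover have "?h U \<in> homog_part (polyring n) (j - Suc i)"
          using * by (fastforce simp: homog_part_def polyring_def in_keys_iff)
        ultimately show ?thesis by simp
      qed
    qed
    have "kdiff n ?h = c"
    proof (rule ext, rule poly_mapping_eqI)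
      fix T u
      show "Poly_Mapping.lookup (kdiff n ?h T) u = Poly_Mapping.lookup (c T) u"
      proof (cases "T \<subseteq> {1..n} \<and> card T = i \<and> u \<in> Mon n \<and> i + tdeg u = j")
        case False
        have "Poly_Mapping.lookup (kdiff n ?h T) u = 0"
        proof (rule ccontr)
          assume nz: "Poly_Mapping.lookup (kdiff n ?h T) u \<noteq> 0"
          have k: "kdiff n ?h \<in> koszul n (polyring n) i j"
            by (rule kdiff_in_koszul[OF is_ideal_polyring h])
          have T: "T \<subseteq> {1..n} \<and> card T = i \<and> i \<le> j"
          proof (rule ccontr)
            assume "\<not> (T \<subseteq> {1..n} \<and> card T = i \<and> i \<le> j)"
            from koszul_outside[OF k this] show False using nz by simp
          qed
          then have "kdiff n ?h T \<in> homog_part (polyring n) (j - i)"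
            using koszul_inside[OF k] by blast
          then show False using T nz False by (auto simp: homog_part_def polyring_def in_keys_iff)
        qed
        moreover have "Poly_Mapping.lookup (c T) u = 0" using c_nz False by blast
        ultimately show ?thesis by simp
      next
        case True
        then have T: "finite T" "T \<subseteq> {1..n}" and u: "supp u \<subseteq> {1..n}" and fu: "finite (supp u)"
          using finite_subset[of T "{1..n}"] by (auto simp: Mon_def supp_def)
        define m where "m = Max (T \<union> supp u)"
        have ne: "T \<union> supp u \<noteq> {}"
          using True ij by (auto simp: tdeg_def supp_def)
        have mle: "x \<le> m" if "x \<in> T \<union> supp u" for x
          using that T fu unfolding m_def by (intro Max_ge) auto
        have m: "m \<in> T \<union> supp u" unfolding m_def using ne T fu by (intro Max_in) auto
        have mn: "m \<in> {1..n}" using m T u by auto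
        have key: "supp (w - var k) \<subseteq> supp w" for w k
          by (auto simp: supp_def in_keys_iff lookup_minus)
        have uk: "u - var k + var k = u" if "k \<in> supp u" for k
          using that by (auto simp: var_def supp_def in_keys_iff lookup_add lookup_minus
              lookup_single when_def intro!: poly_mapping_eqI)
        let ?A = "{k \<in> {1..n} - T. k \<in> supp u}"
        let ?s = "\<lambda>k. (-1) ^ card {t\<in>T. t < k} :: 'k"
        have dh: "Poly_Mapping.lookup (kdiff n ?h T) u =
            (\<Sum>k\<in>?A. ?s k * Poly_Mapping.lookup (?h (insert k T)) (u - var k))"
          by (rule lookup_kdiff)
        show ?thesis
        proof (cases "m \<in> T")
          case False
          then have mu: "m \<in> supp u" using m by simp
          have Tm: "{t\<in>T. t < m} = T" using mle False by (auto simp: order.strict_iff_order)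
          have "?s k * Poly_Mapping.lookup (?h (insert k T)) (u - var k) =
              (if k = m then Poly_Mapping.lookup (c T) u else 0)" if k: "k \<in> ?A" for k
          proof (cases "k = m")
            case True
            have M: "Max (insert m T) = m"
              using T mle by (intro Max_eqI) auto
            have "supp (u - var m) \<subseteq> {..m}" using key[of u m] mle by auto
            then have "Poly_Mapping.lookup (?h (insert m T)) (u - var m) =
                (-1) ^ card T * Poly_Mapping.lookup (c T) u"
              using T False by (subst lookup_khomotopy) (auto simp: M uk[OF mu])
            then show ?thesis using True Tm by (simp add: power_add[symmetric] mult.assoc[symmetric])
          next
            case kn: False
            have "Max (insert k T) \<in> insert k T" using T by (intro Max_in) auto
            then have "Max (insert k T) < m"
              using k kn False mle by (auto simp: order.strict_iff_order)
            moreover have "m \<in> supp (u - var k)"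
              using mu kn by (auto simp: supp_def in_keys_iff lookup_minus var_def lookup_single)
            ultimately have "\<not> supp (u - var k) \<subseteq> {..Max (insert k T)}" by auto
            then show ?thesis using T kn by (subst lookup_khomotopy) auto
          qed
          then have "Poly_Mapping.lookup (kdiff n ?h T) u =
              (\<Sum>k\<in>?A. if k = m then Poly_Mapping.lookup (c T) u else 0)"
            unfolding dh by (rule sum.cong[OF refl])
          also have "\<dots> = Poly_Mapping.lookup (c T) u"
            using False mu mn by simp
          finally show ?thesis .
        next
          case mT: True
          let ?T = "T - {m}"
          let ?g = "\<lambda>k. Poly_Mapping.lookup (c (insert k ?T)) (u + var m - var k)"
          have k_less: "k < m" if "k \<in> ?A" for k
            using that mle[of k] mT by (auto simp: order.strict_iff_order)
          have sg: "{t\<in>T. t < k} = {t\<in>?T. t < k}" if "k \<le> m" for k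
            using that by auto
          have cardT: "card T = Suc (card ?T)" using T mT by (metis card_Suc_Diff1)
          have "Poly_Mapping.lookup (?h (insert k T)) (u - var k) = (-1) ^ card T * ?g k"
            if k: "k \<in> ?A" for k
          proof -
            have M: "Max (insert k T) = m"
              using T mle mT k_less[OF k] by (intro Max_eqI) auto
            have "supp (u - var k) \<subseteq> {..m}" using key[of u k] mle by auto
            moreover have "insert k T - {m} = insert k ?T" using k_less[OF k] by auto
            moreover have "u - var k + var m = u + var m - var k"
              using k uk[of k] by (metis (no_types, lifting) add.commute add.left_commute
                  add_diff_cancel_left' mem_Collect_eq)
            ultimately show ?thesis using T k by (subst lookup_khomotopy) (auto simp: M)
          qed
          then have eq: "Poly_Mapping.lookup (kdiff n ?h T) u = (-1) ^ card T * (\<Sum>k\<in>?A. ?s k * ?g k)"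
            unfolding dh sum_distrib_left by (intro sum.cong) auto
          have "0 = Poly_Mapping.lookup (kdiff n c ?T) (u + var m)" using dc by simp
          also have "\<dots> = (\<Sum>k\<in>{k \<in> {1..n} - ?T. k \<in> supp (u + var m)}.
              (-1) ^ card {t\<in>?T. t < k} * ?g k)" by (rule lookup_kdiff)
          also have "{k \<in> {1..n} - ?T. k \<in> supp (u + var m)} = insert m ?A"
            using mn mT by (auto simp: supp_add) (auto simp: supp_def var_def)
          also have "(\<Sum>k\<in>insert m ?A. (-1) ^ card {t\<in>?T. t < k} * ?g k) =
              (\<Sum>k\<in>insert m ?A. ?s k * ?g k)"
          proof (rule sum.cong[OF refl])
            fix k assume "k \<in> insert m ?A"
            then have "k \<le> m" using k_less by force
            then show "(-1) ^ card {t\<in>?T. t < k} * ?g k = ?s k * ?g k" by (simp only: sg)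
          qed
          also have "\<dots> = ?s m * ?g m + (\<Sum>k\<in>?A. ?s k * ?g k)"
            using mT by (subst sum.insert) auto
          also have "?g m = Poly_Mapping.lookup (c T) u"
            using mT by (simp add: insert_absorb)
          also have "{t\<in>T. t < m} = ?T" using mle by (auto simp: order.strict_iff_order)
          finally have "(\<Sum>k\<in>?A. ?s k * ?g k) = - ((-1) ^ card ?T * Poly_Mapping.lookup (c T) u)"
            by (simp add: eq_neg_iff_add_eq_0 add.commute)
          then show ?thesis
            unfolding eq by (simp add: cardT power_add[symmetric] mult.assoc[symmetric])
        qed
      qed
    qed
    then show "c \<in> kboundaries n (polyring n) i j"
      unfolding kboundaries_def using h by (metis image_eqI)
  qed
qed

end

(* Stability gives beta_{k,k+l}(I) <> 0 iff some u in G(I) of degree l has max(u) >= k + l. So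
   different corners (k, l) have different k, and k + l <= n. A corner (b, 2) puts x_1 x_j in I for
   2 <= j <= b + 2; hence a generator u of degree l >= 3 containing x_1 would have
   max(u) >= b + l + 1, which the corner (b, 2) forbids. Without x_1 it has max(u) >= l + 1, so every
   corner other than (b, 2) has 1 <= k <= n - 3. If n >= 5, the values 1 and n - 3 do not both occur:
   k = n - 3 forces l = 3 and then x_2 x_3 x_4 in I, while k = 1 needs a minimal generator
   x_2 ... x_{l+1} with l > 3. *)

theory Submission
  imports Defs
begin

section \<open>Betti numbers and cycles\<close>

text \<open>A cycle that is no boundary extends a basis of the boundaries to a larger independent
  set of cycles. Since the Koszul module is finite-dimensional, that set is finite, so the truncated
  difference defining \<open>betti\<close> is positive.\<close>

lemma betti_neq_0_iff:
  fixes I :: "'k::field mpoly set"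
  assumes I: "is_ideal n I"
  shows "betti n I i j \<noteq> 0 \<longleftrightarrow> \<not> kcycles n I i j \<subseteq> kboundaries n I i j"
proof
  assume "betti n I i j \<noteq> 0"
  then show "\<not> kcycles n I i j \<subseteq> kboundaries n I i j"
    using kboundaries_le_kcycles[OF I, of i j] by (metis betti_def diff_self_eq_0 subset_antisym)
next
  let ?Z = "kcycles n I i j" and ?B = "kboundaries n I i j"
  assume "\<not> ?Z \<subseteq> ?B"
  then obtain c where c: "c \<in> ?Z" "c \<notin> ?B" by blast
  obtain S where S: "finite S" "koszul n I i j \<subseteq> kvs.span S"
    using koszul_finite_dim[OF I] by blast
  have ZS: "?Z \<subseteq> kvs.span S" using S by (auto simp: kcycles_def)
  obtain B0 where B0: "B0 \<subseteq> ?B" "kvs.independent B0" "?B \<subseteq> kvs.span B0" "card B0 = kvs.dim ?B"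
    using kvs.basis_exists by blast
  have "kvs.span B0 \<subseteq> ?B"
    using B0(1) subspace_kboundaries[OF I] by (rule kvs.span_minimal)
  then have "c \<notin> kvs.span B0" using c by blast
  then have "kvs.independent (insert c B0)" using B0(2) by (simp add: kvs.independent_insert)
  moreover have "insert c B0 \<subseteq> ?Z"
    using c B0 kboundaries_le_kcycles[OF I] by blast
  ultimately obtain B1 where B1: "insert c B0 \<subseteq> B1" "B1 \<subseteq> ?Z" "kvs.independent B1" "?Z \<subseteq> kvs.span B1"
    by (metis kvs.maximal_independent_subset_extend)
  have fin: "finite B1"
    using kvs.independent_span_bound[OF S(1) B1(3)] B1(2) ZS by blast
  have "c \<notin> B0" using B0 c by blast
  then have "B0 \<subset> B1" using B1 by blast
  then have "card B0 < card B1" using fin by (rule psubset_card_mono[rotated])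
  then show "betti n I i j \<noteq> 0"
    using B0(4) kvs.basis_card_eq_dim[OF B1(2,4,3)] by (simp add: betti_def)
qed

section \<open>Squarefree monomials\<close>

text \<open>Identifies squarefree monomials with finite index sets; an infinite \<open>W\<close>
  gives the exponent vector 0 by the convention for sums.\<close>

definition sqmon :: "nat set \<Rightarrow> mon"
  where "sqmon W = (\<Sum>i\<in>W. var i)"

lemma lookup_var: "Poly_Mapping.lookup (var i) j = (if i = j then 1 else 0)"
  by (simp add: var_def lookup_single when_def)

lemma lookup_sqmon: "finite W \<Longrightarrow> Poly_Mapping.lookup (sqmon W) j = (if j \<in> W then 1 else 0)"
  by (simp add: sqmon_def lookup_sum lookup_var)

lemma supp_var [simp]: "supp (var i) = {i}"
  by (auto simp: supp_def in_keys_iff lookup_var split: if_splits)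

lemma supp_sqmon [simp]: "finite W \<Longrightarrow> supp (sqmon W) = W"
  by (auto simp: supp_def in_keys_iff lookup_sqmon split: if_splits)

lemma sqmon_insert: "finite W \<Longrightarrow> i \<notin> W \<Longrightarrow> sqmon (insert i W) = var i + sqmon W"
  by (simp add: sqmon_def)

lemma sqmon_union: "finite A \<Longrightarrow> finite B \<Longrightarrow> A \<inter> B = {} \<Longrightarrow> sqmon (A \<union> B) = sqmon A + sqmon B"
  by (simp add: sqmon_def sum.union_disjoint)

lemma tdeg_sqmon: "finite W \<Longrightarrow> tdeg (sqmon W) = card W"
  by (simp add: tdeg_superset[of W] lookup_sqmon)

lemma finite_supp [simp]: "finite (supp u)"
  by (simp add: supp_def)

lemma in_supp_iff: "i \<in> supp u \<longleftrightarrow> Poly_Mapping.lookup u i \<noteq> 0"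
  by (simp add: supp_def in_keys_iff)

lemma sqfree_mon_eq:
  assumes "sqfree_mon u" shows "sqmon (supp u) = u"
proof (rule poly_mapping_eqI)
  fix i
  have "Poly_Mapping.lookup u i \<le> 1" using assms by (simp add: sqfree_mon_def)
  then show "Poly_Mapping.lookup (sqmon (supp u)) i = Poly_Mapping.lookup u i"
    by (simp add: lookup_sqmon in_supp_iff)
qed

lemma minus_var_add: "i \<in> supp u \<Longrightarrow> u - var i + var i = u"
  by (rule poly_mapping_eqI) (auto simp: lookup_add lookup_minus lookup_var in_supp_iff)

lemma supp_minus: "supp (u - v) \<subseteq> supp u"
  by (auto simp: in_supp_iff lookup_minus)

section \<open>Contracting the Koszul complex\<close>

text \<open>A homotopy that, in multidegree \<open>a\<close>, contracts towards \<open>e\<^sub>i\<close> with \<open>i = ix a\<close>: the term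
  \<open>x\<^sup>v e\<^sub>T\<close> goes to \<open>\<plusminus> (x\<^sup>v / x\<^sub>i) e\<^sub>T\<^sub>'\<close>, \<open>T' = T \<union> {i}\<close>, or to \<open>0\<close> if \<open>i \<in> T\<close>.\<close>

definition contraction :: "(mon \<Rightarrow> nat) \<Rightarrow> (nat set \<Rightarrow> 'k::field mpoly) \<Rightarrow> nat set \<Rightarrow> 'k mpoly"
  where "contraction ix c U = (if infinite U then 0 else
    Abs_poly_mapping (\<lambda>u. let i = ix (u + sqmon U) in if i \<in> U
      then (-1) ^ card {t\<in>U. t < i} * Poly_Mapping.lookup (c (U - {i})) (u + var i) else 0))"

text \<open>\<open>Abs_poly_mapping\<close> needs finite support: each nonzero coefficient comes
  from a term of some \<open>c (U - {i})\<close> with \<open>i\<close> in the finite set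
  \<open>U\<close>.\<close>

lemma lookup_contraction:
  assumes "finite U" "ix (u + sqmon U) = i"
  shows "Poly_Mapping.lookup (contraction ix c U) u = (if i \<in> U
    then (-1) ^ card {t\<in>U. t < i} * Poly_Mapping.lookup (c (U - {i})) (u + var i) else 0)"
proof -
  let ?f = "\<lambda>u. let i = ix (u + sqmon U) in if i \<in> U
      then (-1) ^ card {t\<in>U. t < i} * Poly_Mapping.lookup (c (U - {i})) (u + var i) else 0"
  have "{u. ?f u \<noteq> 0} \<subseteq> (\<Union>i\<in>U. (\<lambda>v. v - var i) ` Poly_Mapping.keys (c (U - {i})))"
  proof
    fix u assume "u \<in> {u. ?f u \<noteq> 0}"
    then have i: "ix (u + sqmon U) \<in> U"
      and "u + var (ix (u + sqmon U)) \<in> Poly_Mapping.keys (c (U - {ix (u + sqmon U)}))"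
      by (auto simp: Let_def in_keys_iff split: if_splits)
    from imageI[OF this(2), of "\<lambda>v. v - var (ix (u + sqmon U))"] i
    show "u \<in> (\<Union>i\<in>U. (\<lambda>v. v - var i) ` Poly_Mapping.keys (c (U - {i})))" by auto
  qed
  then have "finite {u. ?f u \<noteq> 0}" by (rule finite_subset) (use assms in simp)
  then show ?thesis using assms by (simp add: contraction_def Let_def)
qed

lemma lookup_koszul_neq_0:
  assumes "is_ideal n I" "c \<in> koszul n I i j" "Poly_Mapping.lookup (c T) u \<noteq> 0"
  shows "T \<subseteq> {1..n}" "card T = i" "u \<in> Mon n" "i + tdeg u = j"
proof -
  have *: "T \<subseteq> {1..n} \<and> card T = i \<and> i \<le> j"
    using koszul_outside[OF assms(2), of T] assms(3) by (metis lookup_zero)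
  then have "c T \<in> homog_part I (j - i)" using koszul_inside[OF assms(2)] by blast
  then have "Poly_Mapping.keys (c T) \<subseteq> Mon n" "\<forall>u\<in>Poly_Mapping.keys (c T). tdeg u = j - i"
    using assms(1) by (auto simp: homog_part_def is_ideal_def polyring_def)
  then show "T \<subseteq> {1..n}" "card T = i" "u \<in> Mon n" "i + tdeg u = j"
    using * assms(3) by (auto simp: in_keys_iff)
qed

lemma koszulI:
  assumes "is_ideal n I" "\<And>T. c T \<in> I"
    and nz: "\<And>T u. Poly_Mapping.lookup (c T) u \<noteq> 0 \<Longrightarrow> T \<subseteq> {1..n} \<and> card T = i \<and> i + tdeg u = j"
  shows "c \<in> koszul n I i j"
  unfolding koszul_def
proof (intro CollectI allI)
  fix T
  show "c T \<in> (if T \<subseteq> {1..n} \<and> card T = i \<and> i \<le> j then homog_part I (j - i) else {0})"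
  proof (cases "c T = 0")
    case True
    then show ?thesis using homog_part_zero[OF assms(1)] by auto
  next
    case False
    then obtain u where "Poly_Mapping.lookup (c T) u \<noteq> 0"
      by (metis lookup_zero poly_mapping_eqI)
    from nz[OF this] have "T \<subseteq> {1..n} \<and> card T = i \<and> i \<le> j" by auto
    moreover have "c T \<in> homog_part I (j - i)"
      using assms(2) nz by (fastforce simp: homog_part_def in_keys_iff)
    ultimately show ?thesis by simp
  qed
qed

text \<open>The index \<open>ix\<close> depends only on the multidegree, which \<open>kdiff\<close>
  preserves, so the contraction works in one multidegree at a time and sends a cycle
  \<open>c\<close> to a chain with boundary \<open>c\<close>. By \<open>contr\<close> the terms of
  this chain lie in \<open>I\<close>, and \<open>mon\<close> passes from terms to
  polynomials.\<close>

lemma kcycle_is_boundary: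
  fixes I :: "'k::field mpoly set"
  assumes I: "is_ideal n I"
    and mon: "\<And>p. p \<in> polyring n \<Longrightarrow> (\<And>u. u \<in> Poly_Mapping.keys p \<Longrightarrow> xmon u \<in> I) \<Longrightarrow> p \<in> I"
    and c: "c \<in> kcycles n I i j"
    and ix: "\<And>a. tdeg a = j \<Longrightarrow> ix a \<in> supp a"
    and contr: "\<And>T u. Poly_Mapping.lookup (c T) u \<noteq> 0 \<Longrightarrow> ix (u + sqmon T) \<notin> T \<Longrightarrow>
      xmon (u - var (ix (u + sqmon T))) \<in> I"
  shows "c \<in> kboundaries n I i j"
proof -
  let ?h = "contraction ix c"
  have ck: "c \<in> koszul n I i j" and dc: "kdiff n c = 0" using c by (auto simp: kcycles_def)
  have h_nz: "U \<subseteq> {1..n} \<and> card U = Suc i \<and> u \<in> Mon n \<and> Suc i + tdeg u = j \<and> xmon u \<in> I"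
    if nz: "Poly_Mapping.lookup (?h U) u \<noteq> 0" for U u
  proof -
    have fU: "finite U" using nz by (auto simp: contraction_def split: if_splits)
    define m where "m = ix (u + sqmon U)"
    have l: "m \<in> U" "Poly_Mapping.lookup (c (U - {m})) (u + var m) \<noteq> 0"
      using nz lookup_contraction[where ix=ix and c=c, OF fU m_def[symmetric]]
      by (auto split: if_splits)
    note k = lookup_koszul_neq_0[OF I ck l(2)]
    \<comment> \<open>Moving x_m from the coefficient into the exterior part keeps the multidegree,
      so \<open>ix\<close> picks the same \<open>m\<close> for the term of \<open>c\<close>.\<close>
    have "sqmon U = var m + sqmon (U - {m})"
      using sqmon_insert[of "U - {m}" m] fU l(1) by (simp add: insert_absorb)
    then have e: "u + sqmon U = (u + var m) + sqmon (U - {m})" by (simp add: add.assoc)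
    have "ix ((u + var m) + sqmon (U - {m})) = m" by (simp only: e[symmetric]) (simp add: m_def)
    then have "xmon u \<in> I" using contr[OF l(2)] by simp
    moreover have "card U = Suc i" using k(2) fU l(1) by (metis card_Suc_Diff1)
    moreover have "var m \<in> Mon n" "u \<in> Mon n" using k(3) by (simp_all add: Mon_add)
    moreover have "U \<subseteq> {1..n}" using k(1) \<open>var m \<in> Mon n\<close> by (auto simp: Mon_def)
    ultimately show ?thesis using k(4) by (simp add: tdeg_add)
  qed
  have hk: "?h \<in> koszul n I (Suc i) j"
  proof (rule koszulI[OF I])
    show "?h T \<in> I" for T
    proof (rule mon)
      show "?h T \<in> polyring n" using h_nz[of T] unfolding polyring_def in_keys_iff[symmetric] by blast
    qed (use h_nz[of T] in \<open>simp add: in_keys_iff\<close>)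
  qed (use h_nz in metis)
  have "kdiff n ?h = c"
  proof (rule ext, rule poly_mapping_eqI)
    fix T u
    show "Poly_Mapping.lookup (kdiff n ?h T) u = Poly_Mapping.lookup (c T) u"
    proof (cases "T \<subseteq> {1..n} \<and> card T = i \<and> u \<in> Mon n \<and> i + tdeg u = j")
      case False
      then show ?thesis
        using lookup_koszul_neq_0[OF I ck] lookup_koszul_neq_0[OF I kdiff_in_koszul[OF I hk]] by metis
    next
      case True
      then have T: "finite T" "T \<subseteq> {1..n}" and u: "supp u \<subseteq> {1..n}"
        using finite_subset[of T "{1..n}"] by (auto simp: Mon_def)
      define m where "m = ix (u + sqmon T)"
      have "tdeg (u + sqmon T) = j" using True T by (simp add: tdeg_add tdeg_sqmon)
      then have m: "m \<in> supp u \<union> T" unfolding m_def using T ix[of "u + sqmon T"] by (simp add: supp_add)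
      let ?A = "{k \<in> {1..n} - T. k \<in> supp u}"
      let ?s = "\<lambda>k T. (-1) ^ card {t\<in>T. t < k} :: 'k"
      have hT: "Poly_Mapping.lookup (?h (insert k T)) (u - var k) = (if m \<in> insert k T then
          ?s m (insert k T) * Poly_Mapping.lookup (c (insert k T - {m})) (u - var k + var m) else 0)"
        if k: "k \<in> ?A" for k
      proof (rule lookup_contraction)
        have "u - var k + sqmon (insert k T) = u + sqmon T"
          using k T minus_var_add[of k u] by (simp add: sqmon_insert add.assoc[symmetric])
        then show "ix (u - var k + sqmon (insert k T)) = m" by (simp add: m_def)
      qed (use T in simp)
      have dh: "Poly_Mapping.lookup (kdiff n ?h T) u =
          (\<Sum>k\<in>?A. ?s k T * Poly_Mapping.lookup (?h (insert k T)) (u - var k))"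
        by (rule lookup_kdiff)
      show ?thesis
      proof (cases "m \<in> T")
        case False
        \<comment> \<open>A term of the contraction at \<open>insert k T\<close> needs
          \<open>m\<close> in that set, so only \<open>k = m\<close> contributes; its sign occurs
          twice and cancels.\<close>
        have "?s k T * Poly_Mapping.lookup (?h (insert k T)) (u - var k) =
            (if k = m then Poly_Mapping.lookup (c T) u else 0)" if k: "k \<in> ?A" for k
        proof (cases "k = m")
          case True
          have "{t \<in> insert m T. t < m} = {t\<in>T. t < m}" by auto
          then show ?thesis using hT[OF k] True k False minus_var_add[of m u]
            by (simp add: power_add[symmetric] mult.assoc[symmetric])
        qed (use hT[OF k] False in auto)
        then have "Poly_Mapping.lookup (kdiff n ?h T) u =
            (\<Sum>k\<in>?A. if k = m then Poly_Mapping.lookup (c T) u else 0)"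
          unfolding dh by (rule sum.cong[OF refl])
        also have "\<dots> = Poly_Mapping.lookup (c T) u" using False m u by auto
        finally show ?thesis .
      next
        case mT: True
        let ?R = "T - {m}"
        let ?g = "\<lambda>k. Poly_Mapping.lookup (c (insert k ?R)) (u + var m - var k)"
        have summand: "?s k T * Poly_Mapping.lookup (?h (insert k T)) (u - var k) =
            - (?s m ?R * (?s k ?R * ?g k))" if k: "k \<in> ?A" for k
        proof -
          have km: "k \<noteq> m" using k mT by auto
          have "u - var k + var m = u + var m - var k"
            using k by (intro poly_mapping_eqI) (auto simp: lookup_add lookup_minus lookup_var in_supp_iff)
          moreover have "insert k T - {m} = insert k ?R" using km by auto
          \<comment> \<open>Anticommutation: the larger of \<open>k\<close> and \<open>m\<close> has
            the other below it, which costs exactly one sign.\<close>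
          moreover have "?s k T * ?s m (insert k T) = - (?s m ?R * ?s k ?R)"
          proof (cases "k < m")
            case True
            then have "{t\<in>T. t < k} = {t\<in>?R. t < k}" "{t\<in>insert k T. t < m} = insert k {t\<in>?R. t < m}"
              using k mT by auto
            then show ?thesis using k T by simp
          next
            case False
            then have "{t\<in>T. t < k} = insert m {t\<in>?R. t < k}" "{t\<in>insert k T. t < m} = {t\<in>?R. t < m}"
              using k mT km by auto
            then show ?thesis using T by simp
          qed
          ultimately show ?thesis using hT[OF k] mT
            by (simp add: mult.assoc[symmetric])
        qed
        \<comment> \<open>The cycle condition at T - {m} and u x_m expresses the coefficient of
          \<open>c T\<close> at \<open>u\<close> by the terms that the contraction produces.\<close>
        have "0 = Poly_Mapping.lookup (kdiff n c ?R) (u + var m)" using dc by simp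
        also have "\<dots> = (\<Sum>k\<in>{k \<in> {1..n} - ?R. k \<in> supp (u + var m)}. ?s k ?R * ?g k)"
          by (rule lookup_kdiff)
        also have "{k \<in> {1..n} - ?R. k \<in> supp (u + var m)} = insert m ?A"
          using T mT by (auto simp: supp_add)
        also have "(\<Sum>k\<in>insert m ?A. ?s k ?R * ?g k) = ?s m ?R * Poly_Mapping.lookup (c T) u
            + (\<Sum>k\<in>?A. ?s k ?R * ?g k)"
          using mT by (subst sum.insert) (auto simp: insert_absorb)
        finally have "(\<Sum>k\<in>?A. ?s k ?R * ?g k) = - (?s m ?R * Poly_Mapping.lookup (c T) u)"
          by (simp add: eq_neg_iff_add_eq_0 add.commute)
        moreover have "Poly_Mapping.lookup (kdiff n ?h T) u = - (?s m ?R * (\<Sum>k\<in>?A. ?s k ?R * ?g k))"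
          unfolding dh using summand by (simp add: sum_distrib_left sum_negf)
        ultimately show ?thesis
          by (simp add: power_add[symmetric] mult.assoc[symmetric])
      qed
    qed
  qed
  then show ?thesis unfolding kboundaries_def using hk by (metis image_eqI)
qed

section \<open>Squarefree strongly stable ideals\<close>

locale sqfree_strongly_stable =
  fixes n :: nat and I :: "'k::field mpoly set"
  assumes stable: "squarefree_strongly_stable n I"
begin

lemma gens:
  obtains U where "U \<subseteq> Mon n" "\<And>u. u \<in> U \<Longrightarrow> sqfree_mon u" "I = monomial_ideal n U"
  using stable unfolding squarefree_strongly_stable_def squarefree_monomial_ideal_def by blast

lemma min_gens_iff:
  "u \<in> min_gens n I \<longleftrightarrow> u \<in> Mon n \<and> xmon u \<in> I \<and> (\<forall>v w. u = v + w \<and> xmon v \<in> I \<longrightarrow> v = u)"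
  by (rule gens) (simp add: min_gens_eq(1))

lemma ideal: "is_ideal n I"
  by (rule gens) (simp add: is_ideal_monomial_ideal)

lemma monomial_ideal_min_gens: "monomial_ideal n (min_gens n I) = I"
proof -
  obtain U where U: "U \<subseteq> Mon n" "I = monomial_ideal n U" by (rule gens)
  from min_gens_eq(2)[OF U] show ?thesis unfolding min_gens_eq(1)[OF U] .
qed

lemma mem_iff:
  "p \<in> I \<longleftrightarrow> p \<in> polyring n \<and> (\<forall>u\<in>Poly_Mapping.keys p. \<exists>v\<in>min_gens n I. \<exists>w. u = v + w)"
proof -
  have "min_gens n I \<subseteq> Mon n" by (auto simp: min_gens_iff)
  from monomial_ideal_iff[OF this, of p] show ?thesis by (simp add: monomial_ideal_min_gens)
qed

lemma xmon_mem_iff: "xmon u \<in> I \<longleftrightarrow> u \<in> Mon n \<and> (\<exists>v\<in>min_gens n I. \<exists>w. u = v + w)"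
  unfolding mem_iff by (auto simp: xmon_def polyring_def)

lemma memI:
  "p \<in> polyring n \<Longrightarrow> (\<And>u. u \<in> Poly_Mapping.keys p \<Longrightarrow> xmon u \<in> I) \<Longrightarrow> p \<in> I"
  unfolding mem_iff[of p] xmon_mem_iff by blast

lemma lookup_mem: "p \<in> I \<Longrightarrow> Poly_Mapping.lookup p u \<noteq> 0 \<Longrightarrow> xmon u \<in> I"
  unfolding mem_iff[of p] xmon_mem_iff by (auto simp: polyring_def in_keys_iff)

lemma xmon_add_mem: "xmon u \<in> I \<Longrightarrow> w \<in> Mon n \<Longrightarrow> xmon (u + w) \<in> I"
  unfolding xmon_mem_iff Mon_add by (metis add.assoc)

text \<open>Some given squarefree generator divides \<open>u\<close>, and minimality makes it equal
  to \<open>u\<close>.\<close>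

lemma sqfree_min_gens:
  assumes "u \<in> min_gens n I" shows "sqfree_mon u"
proof -
  obtain U where U: "U \<subseteq> Mon n" "\<And>u. u \<in> U \<Longrightarrow> sqfree_mon u" "I = monomial_ideal n U"
    by (rule gens) blast
  have *: "xmon v \<in> I \<longleftrightarrow> v \<in> Mon n \<and> (\<exists>g\<in>U. \<exists>w. v = g + w)" for v
    unfolding U(3) monomial_ideal_iff[OF U(1)] by (auto simp: xmon_def polyring_def)
  obtain g w where g: "g \<in> U" "u = g + w"
    using assms * by (auto simp: min_gens_iff)
  have "xmon g \<in> I" using g(1) U(1) by (auto simp: * intro!: bexI[of _ g] exI[of _ 0])
  then have "g = u" using assms g by (auto simp: min_gens_iff)
  then show ?thesis using U(2) g(1) by simp
qed

lemma sqmon_supp_min_gens: "u \<in> min_gens n I \<Longrightarrow> sqmon (supp u) = u"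
  by (simp add: sqfree_min_gens sqfree_mon_eq)

lemma tdeg_min_gens: "u \<in> min_gens n I \<Longrightarrow> tdeg u = card (supp u)"
  using sqmon_supp_min_gens[of u] tdeg_sqmon[of "supp u"] by simp

lemma supp_min_gens: "u \<in> min_gens n I \<Longrightarrow> supp u \<subseteq> {1..n}"
  by (simp add: min_gens_iff Mon_def)

section \<open>Divisibility, cancellation and exchange in the ideal\<close>

lemma min_gens_minimal:
  assumes "u \<in> min_gens n I" "xmon (sqmon A) \<in> I" "A \<subseteq> supp u"
  shows "A = supp u"
proof -
  have A: "finite A" using assms(3) by (rule finite_subset) simp
  have "u = sqmon A + sqmon (supp u - A)"
    using sqmon_union[of A "supp u - A"] A assms(3) sqmon_supp_min_gens[OF assms(1)]
    by (simp add: Un_absorb1)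
  then have "sqmon A = u" using assms(1,2) unfolding min_gens_iff by blast
  then show ?thesis using A by auto
qed

text \<open>The minimal generator dividing u x_i is squarefree, while x_i occurs at least twice in u
  x_i; hence the cofactor can give up one x_i.\<close>

lemma xmon_cancel_var:
  assumes "xmon (u + var i) \<in> I" "i \<in> supp u"
  shows "xmon u \<in> I"
proof -
  obtain g w where g: "g \<in> min_gens n I" "u + var i = g + w" and M: "u \<in> Mon n"
    using assms(1) by (auto simp: xmon_mem_iff Mon_add)
  have "Poly_Mapping.lookup g i \<le> 1" using sqfree_min_gens[OF g(1)] by (simp add: sqfree_mon_def)
  moreover have "Poly_Mapping.lookup u i + 1 = Poly_Mapping.lookup g i + Poly_Mapping.lookup w i"
    using arg_cong[OF g(2), of "\<lambda>x. Poly_Mapping.lookup x i"] by (simp add: lookup_add lookup_var)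
  ultimately have "i \<in> supp w" using assms(2) by (auto simp: in_supp_iff)
  then have "u + var i = g + (w - var i) + var i"
    using g(2) minus_var_add[of i w] by (simp add: add.assoc)
  then have "u = g + (w - var i)" by simp
  then show ?thesis using M g(1) by (auto simp: xmon_mem_iff)
qed

text \<open>Extends stability from minimal generators to all monomials of \<open>I\<close>: with v =
  g w, the factor x_i is replaced inside the generator \<open>g\<close> or, if \<open>g\<close>
  lacks it, inside the cofactor \<open>w\<close>.\<close>

lemma exchange:
  assumes v: "xmon v \<in> I" and i: "i \<in> supp v" and j: "j \<notin> supp v" "1 \<le> j" "j < i"
  shows "xmon (v - var i + var j) \<in> I"
proof -
  obtain g w where g: "g \<in> min_gens n I" "v = g + w" and M: "v \<in> Mon n"
    using v by (auto simp: xmon_mem_iff)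
  have gw: "g \<in> Mon n" "w \<in> Mon n" using M g(2) by (auto simp: Mon_add)
  have "i \<in> {1..n}" using M i by (auto simp: Mon_def)
  then have jM: "var j \<in> Mon n" using j by (auto simp: Mon_def)
  show ?thesis
  proof (cases "i \<in> supp g")
    case True
    have "xmon (g + var j - var i) \<in> I"
      using stable g(1) True j g(2) unfolding squarefree_strongly_stable_def by (simp add: supp_add)
    then have "xmon (g + var j - var i + w) \<in> I" using gw by (simp add: xmon_add_mem)
    moreover have "g + var j - var i + w = v - var i + var j"
      using True j unfolding g(2)
      by (intro poly_mapping_eqI) (auto simp: lookup_add lookup_minus lookup_var in_supp_iff)
    ultimately show ?thesis by simp
  next
    case False
    then have "i \<in> supp w" using i g(2) by (simp add: supp_add)
    then have "v - var i + var j = g + ((w - var i) + var j)"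
      using j unfolding g(2)
      by (intro poly_mapping_eqI) (auto simp: lookup_add lookup_minus lookup_var in_supp_iff)
    moreover have "w - var i + var j \<in> Mon n"
      using gw(2) jM subset_trans[OF supp_minus[of w "var i"]] by (simp add: Mon_add) (simp add: Mon_def)
    ultimately show ?thesis using g(1) gw by (auto simp: xmon_mem_iff Mon_add)
  qed
qed

lemma exchange_sqmon:
  assumes "xmon (sqmon W) \<in> I" "finite W" "i \<in> W" "j \<notin> W" "1 \<le> j" "j < i"
  shows "xmon (sqmon (insert j (W - {i}))) \<in> I"
proof -
  have "sqmon (insert j (W - {i})) = sqmon W - var i + var j"
    using assms(2-6)
    by (intro poly_mapping_eqI) (auto simp: lookup_add lookup_minus lookup_var lookup_sqmon)
  then show ?thesis using exchange[OF assms(1), of i j] assms by simp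
qed

section \<open>Nonzero Betti numbers and the largest index of a minimal generator\<close>

text \<open>Contracting towards an index that occurs twice, or else towards the largest one, fails only at
  the minimal generators \<open>v\<close> whose largest index is also the largest one of the multidegree.\<close>

lemma min_gens_if_betti:
  assumes b: "betti n I k (k + l) \<noteq> 0" and kl: "k + l \<noteq> 0"
  shows "\<exists>u\<in>min_gens n I. tdeg u = l \<and> k + l \<le> Max (supp u)"
proof -
  obtain c where c: "c \<in> kcycles n I k (k + l)" "c \<notin> kboundaries n I k (k + l)"
    using b betti_neq_0_iff[OF ideal] by blast
  have ck: "c \<in> koszul n I k (k + l)" using c by (simp add: kcycles_def)
  define ix where "ix = (\<lambda>a. if sqfree_mon a then Max (supp a)
    else SOME i. Poly_Mapping.lookup a i > 1)"
  have ix2: "Poly_Mapping.lookup a (ix a) > 1" if "\<not> sqfree_mon a" for a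
    using that someI_ex[of "\<lambda>i. Poly_Mapping.lookup a i > 1"]
    by (simp add: ix_def) (auto simp: sqfree_mon_def not_le)
  have ix: "ix a \<in> supp a" if "tdeg a = k + l" for a
  proof (cases "sqfree_mon a")
    case True
    have "supp a \<noteq> {}" using that kl by (auto simp: tdeg_def supp_def)
    then show ?thesis using True Max_in[of "supp a"] by (simp add: ix_def)
  next
    case False
    from ix2[OF this] show ?thesis by (simp add: in_supp_iff)
  qed
  have "\<exists>T v. Poly_Mapping.lookup (c T) v \<noteq> 0 \<and> ix (v + sqmon T) \<notin> T \<and>
      xmon (v - var (ix (v + sqmon T))) \<notin> I"
  proof (rule ccontr)
    assume "\<not> ?thesis"
    then have "c \<in> kboundaries n I k (k + l)"
      by (intro kcycle_is_boundary[OF ideal memI c(1), where ix=ix]) (auto intro: ix)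
    then show False using c(2) by simp
  qed
  then obtain T v where Tv: "Poly_Mapping.lookup (c T) v \<noteq> 0" "ix (v + sqmon T) \<notin> T"
      "xmon (v - var (ix (v + sqmon T))) \<notin> I" by blast
  note k = lookup_koszul_neq_0[OF ideal ck Tv(1)]
  have T: "finite T" using k(1) finite_subset by blast
  have "c T \<in> I" using koszul_inside[OF ck k(1,2)] by (simp add: homog_part_def)
  from lookup_mem[OF this Tv(1)] have vI: "xmon v \<in> I" .
  define a where "a = v + sqmon T"
  define m where "m = ix a"
  have mT: "m \<notin> T" and nI: "xmon (v - var m) \<notin> I" using Tv by (auto simp: m_def a_def)
  have da: "tdeg a = k + l" using k T by (simp add: a_def tdeg_add tdeg_sqmon)
  have ma: "m \<in> supp a" unfolding m_def using da by (rule ix)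
  have mv: "m \<in> supp v" using ma mT T by (simp add: a_def supp_add)
  \<comment> \<open>Otherwise x_m occurs at least twice in \<open>a\<close>, hence in
    \<open>v\<close> because \<open>m\<close> is not in \<open>T\<close>, and one copy can be
    cancelled within \<open>I\<close>.\<close>
  have sf: "sqfree_mon a"
  proof (rule ccontr)
    assume "\<not> sqfree_mon a"
    then have "Poly_Mapping.lookup a m > 1" using ix2 m_def by simp
    then have "m \<in> supp (v - var m)"
      using mT T by (simp add: a_def in_supp_iff lookup_add lookup_minus lookup_sqmon lookup_var)
    then have "xmon (v - var m) \<in> I"
      using xmon_cancel_var[of "v - var m" m] vI minus_var_add[OF mv] by simp
    then show False using nI by simp
  qed
  then have mM: "m = Max (supp a)" by (simp add: m_def ix_def)
  have v1: "Poly_Mapping.lookup v j \<le> 1" for j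
    using sf unfolding sqfree_mon_def a_def lookup_add by (metis add_leE)
  \<comment> \<open>A proper divisor of \<open>v\<close> in \<open>I\<close> would give v / x_j in
    \<open>I\<close> for some j < m; exchanging x_m for x_j there would put v / x_m into
    \<open>I\<close>.\<close>
  have "v' = v" if vw: "v = v' + w" "xmon v' \<in> I" for v' w
  proof (rule ccontr)
    assume "v' \<noteq> v"
    then obtain j where j: "j \<in> supp w"
      using vw(1) by (metis add.right_neutral in_supp_iff lookup_zero poly_mapping_eqI)
    have jv: "j \<in> supp v" using j vw(1) by (simp add: supp_add)
    have w: "w \<in> Mon n" using k(3) vw(1) by (simp add: Mon_add)
    then have "w - var j \<in> Mon n" using supp_minus[of w "var j"] by (auto simp: Mon_def)
    moreover have "v - var j = v' + (w - var j)" unfolding vw(1) using j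
      by (intro poly_mapping_eqI) (auto simp: lookup_add lookup_minus lookup_var in_supp_iff)
    ultimately have jI: "xmon (v - var j) \<in> I" using vw(2) by (simp add: xmon_add_mem)
    have jm: "j \<noteq> m" using jI nI by auto
    have "j \<le> m" unfolding mM using jv by (intro Max_ge) (auto simp: a_def supp_add)
    moreover have "1 \<le> j" using jv k(3) by (auto simp: Mon_def)
    moreover have "m \<in> supp (v - var j)" using mv jm by (simp add: in_supp_iff lookup_minus lookup_var)
    moreover have "j \<notin> supp (v - var j)" using v1[of j] by (simp add: in_supp_iff lookup_minus lookup_var)
    ultimately have "xmon (v - var j - var m + var j) \<in> I" using jI jm by (intro exchange) auto
    moreover have "v - var j - var m + var j = v - var m" using jm jv
      by (intro poly_mapping_eqI) (auto simp: lookup_add lookup_minus lookup_var in_supp_iff)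
    ultimately show False using nI by simp
  qed
  then have "v \<in> min_gens n I" using vI k(3) by (auto simp: min_gens_iff)
  \<comment> \<open>The squarefree monomial \<open>a\<close> has k + l distinct indices, all in
    {1..m}.\<close>
  moreover have "k + l \<le> Max (supp v)"
  proof -
    have "supp a \<subseteq> {1..m}"
      using k(1,3) Max_ge[of "supp a"] T by (fastforce simp: mM a_def supp_add Mon_def)
    from card_mono[OF _ this] have "card (supp a) \<le> m" by simp
    then have "k + l \<le> m" using da tdeg_sqmon[of "supp a"] sqfree_mon_eq[OF sf] by simp
    also have "m \<le> Max (supp v)" using mv by simp
    finally show ?thesis .
  qed
  ultimately show ?thesis using k(4) by auto
qed

text \<open>The boundary of \<open>(u / x\<^sub>m) e\<^sub>U\<close>, \<open>U = T \<union> {m}\<close>, has coefficients in \<open>I\<close> by stability, and no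
  boundary of the Koszul complex of \<open>I\<close> involves \<open>u e\<^sub>T\<close> as \<open>u\<close> is a minimal generator.\<close>

lemma betti_if_min_gens:
  assumes u: "u \<in> min_gens n I" and m: "m \<in> supp u" and T: "T \<subseteq> {1..<m} - supp u"
  shows "betti n I (card T) (card T + tdeg u) \<noteq> 0"
proof -
  let ?i = "card T" and ?j = "card T + tdeg u"
  define v where "v = u - var m"
  have v: "v + var m = u" using minus_var_add[OF m] by (simp add: v_def)
  have uI: "xmon u \<in> I" and uM: "u \<in> Mon n" using u by (auto simp: min_gens_iff)
  have mn: "m \<in> {1..n}" using uM m by (auto simp: Mon_def)
  have vM: "v \<in> Mon n" using uM by (auto simp: v[symmetric] Mon_add)
  have Tn: "T \<subseteq> {1..n}" "m \<notin> T" "finite T" using T mn finite_subset[of T "{1..n}"] by force+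
  define U where "U = insert m T"
  have U: "finite U" "U \<subseteq> {1..n}" "card U = Suc (card T)" using Tn mn by (auto simp: U_def)
  define e :: "nat set \<Rightarrow> 'k mpoly" where "e = (\<lambda>W. if W = U then xmon v else 0)"
  have lookup_e: "Poly_Mapping.lookup (e W) w = (if W = U \<and> w = v then 1 else 0)" for W w
    by (auto simp: e_def xmon_def lookup_single when_def)
  have de: "tdeg u = Suc (tdeg v)" using v by (metis Suc_eq_plus1 tdeg_add tdeg_var)
  \<comment> \<open>As u / x_m is not in \<open>I\<close>, the chain \<open>e\<close> is placed in
    the complex of the whole ring; its boundary \<open>z\<close> is moved into that of
    \<open>I\<close> afterwards.\<close>
  have ek: "e \<in> koszul n (polyring n) (Suc ?i) ?j"
  proof (rule koszulI[OF is_ideal_polyring])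
    show "e W \<in> polyring n" for W
      using xmon_in_polyring[OF vM] by (auto simp: e_def polyring_def)
  qed (use U de in \<open>auto simp: lookup_e split: if_splits\<close>)
  define z where "z = kdiff n e"
  have "z \<in> kcycles n (polyring n) ?i ?j"
    using kboundaries_le_kcycles[OF is_ideal_polyring] ek unfolding z_def kboundaries_def by blast
  then have zk: "z \<in> koszul n (polyring n) ?i ?j" and dz: "kdiff n z = 0" by (auto simp: kcycles_def)
  have zI: "xmon w \<in> I" if nz: "Poly_Mapping.lookup (z W) w \<noteq> 0" for W w
  proof -
    obtain t where t: "t \<in> {1..n} - W" "t \<in> supp w" "Poly_Mapping.lookup (e (insert t W)) (w - var t) \<noteq> 0"
      using nz unfolding z_def lookup_kdiff by (metis (no_types, lifting) mem_Collect_eq mult_zero_right sum.neutral)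
    then have tU: "t \<in> U" and wv: "w = v + var t"
      using minus_var_add[of t w] by (auto simp: lookup_e split: if_splits)
    show ?thesis
    proof (cases "t = m")
      case True
      then show ?thesis using wv v uI by simp
    next
      case False
      then have "t \<in> {1..<m} - supp u" using tU T by (auto simp: U_def)
      then show ?thesis unfolding wv v_def by (intro exchange[OF uI m]) auto
    qed
  qed
  have zI': "z W \<in> I" for W
  proof (rule memI)
    show "z W \<in> polyring n"
      using lookup_koszul_neq_0(3)[OF is_ideal_polyring zk] by (fastforce simp: polyring_def in_keys_iff)
  qed (use zI in \<open>simp add: in_keys_iff\<close>)
  have "z \<in> koszul n I ?i ?j"
    using zI' lookup_koszul_neq_0[OF is_ideal_polyring zk] by (intro koszulI[OF ideal]) auto
  then have zc: "z \<in> kcycles n I ?i ?j" using dz by (simp add: kcycles_def)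
  \<comment> \<open>Only \<open>t = m\<close> turns \<open>T\<close> into \<open>U\<close>, so
    exactly one summand survives and it is a sign.\<close>
  have "Poly_Mapping.lookup (z T) u =
      (\<Sum>t\<in>{t \<in> {1..n} - T. t \<in> supp u}. if t = m then (-1) ^ card {s\<in>T. s < m} else 0)"
    unfolding z_def lookup_kdiff
    by (intro sum.cong) (use Tn in \<open>auto simp: lookup_e U_def v_def\<close>)
  then have zT: "Poly_Mapping.lookup (z T) u \<noteq> 0" using Tn mn m by simp
  have "z \<notin> kboundaries n I ?i ?j"
  proof
    assume "z \<in> kboundaries n I ?i ?j"
    then obtain d where d: "d \<in> koszul n I (Suc ?i) ?j" "z = kdiff n d" by (auto simp: kboundaries_def)
    obtain t where t: "t \<in> supp u" "Poly_Mapping.lookup (d (insert t T)) (u - var t) \<noteq> 0"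
      using zT unfolding d(2) lookup_kdiff
      by (metis (no_types, lifting) mem_Collect_eq mult_zero_right sum.neutral)
    have "d (insert t T) \<in> I"
      using koszul_inside[OF d(1)] lookup_koszul_neq_0(1,2,4)[OF ideal d(1) t(2)]
      by (auto simp: homog_part_def)
    from lookup_mem[OF this t(2)] have "xmon (u - var t) \<in> I" .
    then have "u - var t = u" using u minus_var_add[OF t(1)] unfolding min_gens_iff by metis
    then have "tdeg u = tdeg u + 1" using minus_var_add[OF t(1)] by (metis tdeg_add tdeg_var)
    then show False by simp
  qed
  then show ?thesis using zc betti_neq_0_iff[OF ideal] by blast
qed

lemma betti_eq_0:
  assumes "homog_part I l = {0}" shows "betti n I k (k + l) = 0"
proof -
  have "kcycles n I k (k + l) \<subseteq> {0}"
    using assms by (auto simp: kcycles_def koszul_def fun_eq_iff split: if_splits)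
  also have "\<dots> \<subseteq> kboundaries n I k (k + l)"
    using kvs.subspace_0[OF subspace_kboundaries[OF ideal]] by simp
  finally show ?thesis using betti_neq_0_iff[OF ideal] by blast
qed

end

section \<open>Corners\<close>

lemma cornerD:
  assumes "corner n I (k, l)"
  shows "betti n I k (k + l) \<noteq> 0"
    and "k \<le> i \<Longrightarrow> l \<le> j \<Longrightarrow> betti n I i (i + j) \<noteq> 0 \<Longrightarrow> i = k \<and> j = l"
proof -
  show "betti n I k (k + l) \<noteq> 0" using assms by (simp add: corner_def)
  show "i = k \<and> j = l" if "k \<le> i" "l \<le> j" "betti n I i (i + j) \<noteq> 0"
  proof (rule ccontr)
    assume "\<not> (i = k \<and> j = l)"
    then have "betti n I i (i + j) = 0" using assms that(1,2) by (auto simp: corner_def)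
    then show False using that(3) by simp
  qed
qed

text \<open>Of two corners with the same first entry, the one of smaller degree would make the Betti
  number of the other vanish. Counting corners thus becomes counting first entries.\<close>

lemma inj_on_fst_corners: "inj_on fst {c. corner n I c}"
proof (rule inj_onI, clarsimp)
  fix k l l' assume c: "corner n I (k, l)" "corner n I (k, l')"
  show "l = l'"
    using cornerD(2)[OF c(1) _ _ cornerD(1)[OF c(2)]] cornerD(2)[OF c(2) _ _ cornerD(1)[OF c(1)]]
    by (cases "l \<le> l'") auto
qed

section \<open>Generators and corners in the presence of a corner (b, 2)\<close>

locale corner_in_degree_two = sqfree_strongly_stable +
  fixes b
  assumes initial_degree: "has_initial_degree I 2" and corner_two: "corner n I (b, 2)"
begin

lemma corner_gen:
  assumes "corner n I (k, l)"
  obtains u where "u \<in> min_gens n I" "tdeg u = l" "k + l \<le> Max (supp u)" "2 \<le> l" "k + l \<le> n"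
proof -
  have l: "2 \<le> l"
  proof (rule ccontr)
    assume "\<not> 2 \<le> l"
    then have "homog_part I l = {0}" using initial_degree by (simp add: has_initial_degree_def)
    then show False using betti_eq_0[of l k] cornerD(1)[OF assms] by simp
  qed
  then obtain u where u: "u \<in> min_gens n I" "tdeg u = l" "k + l \<le> Max (supp u)"
    using min_gens_if_betti[OF cornerD(1)[OF assms]] by auto
  have "supp u \<noteq> {}" using u(2) l tdeg_min_gens[OF u(1)] by auto
  then have "Max (supp u) \<in> {1..n}" using subsetD[OF supp_min_gens[OF u(1)] Max_in] by simp
  then show thesis using that[OF u l] u(3) by simp
qed

text \<open>More than \<open>k\<close> gaps below an index of \<open>u\<close> would give a nonzero
  Betti number in degree \<open>l\<close> beyond the corner.\<close>

lemma corner_gap: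
  assumes "corner n I (k, l)" "u \<in> min_gens n I" "tdeg u = l"
    and "m \<in> supp u" "T \<subseteq> {1..<m} - supp u"
  shows "card T \<le> k"
proof (rule ccontr)
  assume "\<not> card T \<le> k"
  then show False
    using cornerD(2)[OF assms(1), of "card T" l] betti_if_min_gens[OF assms(2,4,5)] assms(3) by auto
qed

text \<open>The corner (b, 2) comes from a generator x_a x_m with a < m and m >= b + 2; exchange
  lowers \<open>a\<close> to 1 and then \<open>m\<close> to \<open>j\<close>.\<close>

lemma edge_mem:
  assumes j: "2 \<le> j" "j \<le> b + 2"
  shows "xmon (sqmon {1, j}) \<in> I"
proof -
  obtain u where u: "u \<in> min_gens n I" "tdeg u = 2" "b + 2 \<le> Max (supp u)"
    using corner_gen[OF corner_two] by metis
  define m where "m = Max (supp u)"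
  have c2: "card (supp u) = 2" using tdeg_min_gens[OF u(1)] u(2) by simp
  then have mu: "m \<in> supp u" unfolding m_def by (intro Max_in) auto
  obtain a where a: "supp u = {a, m}" "a \<noteq> m"
    using c2 mu unfolding card_2_iff by (metis doubleton_eq_iff insertE singletonD)
  have am: "a < m" "1 \<le> a"
    using a Max_ge[OF finite_supp, of a u] supp_min_gens[OF u(1)] unfolding m_def[symmetric] by auto
  have uI: "xmon (sqmon {a, m}) \<in> I"
    using sqmon_supp_min_gens[OF u(1)] u(1) by (simp add: a(1) min_gens_iff)
  have "xmon (sqmon {1, m}) \<in> I"
  proof (cases "a = 1")
    case False
    then have "insert 1 ({a, m} - {a}) = {1, m}" using am by auto
    then show ?thesis using exchange_sqmon[OF uI, of a 1] False am by simp
  qed (use uI in simp)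
  show ?thesis
  proof (cases "j = m")
    case False
    then have "j < m" using j u(3) by (simp add: m_def)
    moreover have "insert j ({1, m} - {m}) = {1, j}" using \<open>j < m\<close> j by auto
    ultimately show ?thesis using exchange_sqmon[OF \<open>xmon (sqmon {1, m}) \<in> I\<close>, of m j] j by simp
  qed (use \<open>xmon (sqmon {1, m}) \<in> I\<close> in simp)
qed

text \<open>If x_1 divides \<open>u\<close>, then 2, ..., b + 2 are gaps of \<open>u\<close>, since
  x_1 x_j in \<open>I\<close> would be a proper divisor. These b + 1 gaps lie below another index of
  \<open>u\<close> and contradict the corner (b, 2).\<close>

lemma supp_ge_two:
  assumes u: "u \<in> min_gens n I" and d: "3 \<le> tdeg u"
  shows "supp u \<subseteq> {2..n}"
proof -
  have "1 \<notin> supp u"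
  proof
    assume one: "1 \<in> supp u"
    have c: "3 \<le> card (supp u)" using d tdeg_min_gens[OF u] by simp
    have T: "{2..b + 2} \<inter> supp u = {}"
    proof (rule equals0I)
      fix j assume j: "j \<in> {2..b + 2} \<inter> supp u"
      have "{1, j} = supp u"
        using j one by (intro min_gens_minimal[OF u edge_mem]) auto
      moreover have "card {1, j} \<le> 2" by (simp add: card_insert_if)
      ultimately show False using c by simp
    qed
    have "\<not> supp u \<subseteq> {1}" using c card_mono[of "{1}" "supp u"] by auto
    then obtain m where m: "m \<in> supp u" "m \<noteq> 1" by blast
    have "1 \<le> m" "m \<notin> {2..b + 2}" using m(1) T supp_min_gens[OF u] by auto
    then have mb: "b + 2 < m" using m(2) by simp
    then have "{2..b + 2} \<subseteq> {1..<m} - supp u" using T by auto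
    then have "betti n I (card {2..b + 2}) (card {2..b + 2} + tdeg u) \<noteq> 0"
      by (rule betti_if_min_gens[OF u m(1)])
    then show False using cornerD(2)[OF corner_two, of "b + 1" "tdeg u"] d by simp
  qed
  then have "x \<noteq> 1" if "x \<in> supp u" for x using that by blast
  moreover have "1 \<le> x \<and> x \<le> n" if "x \<in> supp u" for x using that supp_min_gens[OF u] by auto
  ultimately show ?thesis by (fastforce simp: nat_less_le)
qed

text \<open>The index 1 is a gap of the corner's generator, below all its indices.\<close>

lemma corner_pos:
  assumes c: "corner n I (k, l)" and l: "3 \<le> l"
  shows "1 \<le> k"
proof -
  obtain u where u: "u \<in> min_gens n I" "tdeg u = l" using corner_gen[OF c] by metis
  have two: "supp u \<subseteq> {2..n}" using supp_ge_two u l by simp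
  have "supp u \<noteq> {}" using u(2) l tdeg_min_gens[OF u(1)] by auto
  then obtain m where m: "m \<in> supp u" by blast
  have "{1} \<subseteq> {1..<m} - supp u" using m two by auto
  from corner_gap[OF c u m this] show ?thesis by simp
qed

text \<open>A corner \<open>(1, l)\<close> with \<open>l > 3\<close> comes from the generator \<open>x\<^sub>2 \<cdots> x\<^sub>l\<^sub>+\<^sub>1\<close>, whereas a corner
  in degree \<open>3\<close> forces \<open>x\<^sub>2x\<^sub>3x\<^sub>4 \<in> I\<close>.\<close>

lemma not_both_extreme_corners:
  assumes c1: "corner n I (1, l)" and c2: "corner n I (k, 3)" and k: "1 < k" and l: "3 \<le> l"
  shows False
proof -
  \<comment> \<open>For l = 3 the corner (1, 3) would exclude (k, 3), as 1 < k.\<close>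
  have l4: "4 \<le> l" using cornerD(2)[OF c1 _ _ cornerD(1)[OF c2]] l k
    by (cases "l = 3") auto
  obtain u where u: "u \<in> min_gens n I" "tdeg u = l" using corner_gen[OF c1] by metis
  have cu: "card (supp u) = l" using tdeg_min_gens[OF u(1)] u(2) by simp
  have two: "supp u \<subseteq> {2..n}" using supp_ge_two u l by simp
  have mem: "j \<in> supp u" if j: "j \<in> {2..4}" for j
  proof (rule ccontr)
    assume nj: "j \<notin> supp u"
    have "\<exists>m\<in>supp u. j < m"
    proof (rule ccontr)
      assume "\<not> ?thesis"
      \<comment> \<open>With no index above \<open>j\<close>, at most two indices remain, but
        \<open>u\<close> has at least four.\<close>
      then have "supp u \<subseteq> {2..4} - {j}" using j two nj by fastforce
      from card_mono[OF _ this] show False using cu l4 j by simp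
    qed
    then obtain m where m: "m \<in> supp u" "j < m" by blast
    \<comment> \<open>Two gaps, where the corner (1, l) allows one.\<close>
    have "{1, j} \<subseteq> {1..<m} - supp u" using j m two nj by auto
    from corner_gap[OF c1 u m(1) this] show False using j by simp
  qed
  obtain v where v: "v \<in> min_gens n I" "tdeg v = 3" using corner_gen[OF c2] by metis
  \<comment> \<open>Induction on the number of indices above 4: each exchange replaces one of them
    by a missing element of {2..4}.\<close>
  have compress: "xmon (sqmon {2..4}) \<in> I"
    if "xmon (sqmon W) \<in> I" "finite W" "card W = 3" "W \<subseteq> {2..}" for W
    using that
  proof (induction "card (W - {2..4})" arbitrary: W)
    case 0
    then have "W \<subseteq> {2..4}" by simp
    then have "W = {2..4}" using 0 by (intro card_subset_eq) auto
    then show ?case using 0 by simp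
  next
    case (Suc d)
    then obtain i where i: "i \<in> W" "i \<notin> {2..4}"
      by (metis Diff_iff card.empty ex_in_conv nat.distinct(1))
    have "\<not> {2..4} \<subseteq> W"
      using card_subset_eq[of W "{2..4}"] i Suc.prems(2,3) by auto
    then obtain j where j: "j \<in> {2..4}" "j \<notin> W" by blast
    have ij: "j < i" using i j Suc.prems(4) by auto
    let ?W = "insert j (W - {i})"
    have "?W - {2..4} = W - {2..4} - {i}" using j by auto
    then have "card (?W - {2..4}) = d" using Suc.hyps(2) Suc.prems(2) i by simp
    moreover have "card ?W = 3" using Suc.prems(2,3) i j by simp
    ultimately show ?case
      using exchange_sqmon[OF Suc.prems(1,2) i(1) j(2) _ ij] Suc.prems j by (intro Suc.hyps(1)[of ?W]) auto
  qed
  have "xmon (sqmon {2..4}) \<in> I"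
  proof (rule compress)
    show "xmon (sqmon (supp v)) \<in> I"
      using v(1) sqmon_supp_min_gens[OF v(1)] by (simp add: min_gens_iff)
    show "card (supp v) = 3" using tdeg_min_gens[OF v(1)] v(2) by simp
    show "supp v \<subseteq> {2..}" using supp_ge_two[OF v(1)] v(2) by auto
  qed simp
  from min_gens_minimal[OF u(1) this] have "{2..4} = supp u" using mem by blast
  then have "card (supp u) = card {2..4::nat}" by simp
  then show False using cu l4 by simp
qed

section \<open>Counting the corners\<close>

lemma corners_bound:
  assumes n: "n \<ge> 4"
  shows "finite {c. corner n I c} \<and> card {c. corner n I c} \<le> (if n = 4 then n - 2 else n - 3)"
proof -
  \<comment> \<open>First entries of the corners other than (b, 2), which is the only one in degree
    2.\<close>
  define K where "K = fst ` {(k, l). corner n I (k, l) \<and> 3 \<le> l}"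
  have K: "K \<subseteq> {1..n - 3}"
  proof
    fix k assume "k \<in> K"
    then obtain l where l: "corner n I (k, l)" "3 \<le> l" by (auto simp: K_def)
    have "k + l \<le> n" using corner_gen[OF l(1)] by metis
    then show "k \<in> {1..n - 3}" using corner_pos[OF l] l(2) by simp
  qed
  have sub: "fst ` {c. corner n I c} \<subseteq> insert b K"
  proof (rule image_subsetI, clarsimp)
    fix k l assume c: "corner n I (k, l)" and kK: "k \<notin> K"
    then have "l < 3" by (force simp: K_def)
    moreover have "2 \<le> l" using corner_gen[OF c] by metis
    ultimately have "l = 2" by simp
    then show "k = b"
      using cornerD(2)[OF c _ _ cornerD(1)[OF corner_two]] cornerD(2)[OF corner_two _ _ cornerD(1)[OF c]]
      by (cases "k \<le> b") auto
  qed
  have fK: "finite K" using K finite_subset by blast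
  \<comment> \<open>One less than the final bound, to leave room for \<open>b\<close>. For n = 4 the
    range {1..n - 3} is {1}; for larger \<open>n\<close> its two ends differ and one of them is
    missing from \<open>K\<close>.\<close>
  have cK: "card K \<le> (if n = 4 then n - 3 else n - 4)"
  proof (cases "n = 4")
    case True
    then show ?thesis using card_mono[OF _ K] by simp
  next
    case False
    have "\<not> (1 \<in> K \<and> n - 3 \<in> K)"
    proof
      assume "1 \<in> K \<and> n - 3 \<in> K"
      then obtain l l' where l: "corner n I (1, l)" "3 \<le> l" "corner n I (n - 3, l')" "3 \<le> l'"
        by (auto simp: K_def)
      have "n - 3 + l' \<le> n" using corner_gen[OF l(3)] by metis
      then have "l' = 3" using l(4) n by simp
      moreover have "1 < n - 3" using False n by simp
      ultimately show False using not_both_extreme_corners[OF l(1), of "n - 3"] l(2,3) by simp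
    qed
    then have "K \<noteq> {1..n - 3}" using n by auto
    then have "card K < card {1..n - 3}" using K by (intro psubset_card_mono) auto
    then show ?thesis using False by simp
  qed
  have fin: "finite {c. corner n I c}"
    using finite_subset[OF sub] fK inj_on_fst_corners by (auto dest: finite_imageD)
  have "card {c. corner n I c} = card (fst ` {c. corner n I c})"
    using inj_on_fst_corners by (rule card_image[symmetric])
  also have "\<dots> \<le> card (insert b K)" using fK by (intro card_mono[OF _ sub]) simp
  also have "\<dots> \<le> Suc (card K)" by (rule card_insert_le_m1[of "Suc (card K)", simplified]) simp
  finally show ?thesis using fin cK n by (auto split: if_splits)
qed

end

theorem proposition3p7:
  fixes n :: nat and I :: "'k::field mpoly set"
  assumes "n \<ge> 4"
    and "squarefree_strongly_stable n I"
    and "has_initial_degree I 2"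
    and "\<exists>k. corner n I (k, 2)"
  shows "finite {c. corner n I c} \<and>
    (n = 4 \<longrightarrow> card {c. corner n I c} \<le> n - 2) \<and>
    (n \<ge> 5 \<longrightarrow> card {c. corner n I c} \<le> n - 3)"
proof -
  obtain b where "corner n I (b, 2)" using assms(4) ..
  then interpret corner_in_degree_two n I b
    using assms(2,3) by unfold_locales
  show ?thesis using corners_bound[OF assms(1)] by auto
qed

end
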